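(* Let $T$ be an ergodic endomorphism of a probability space $(X,\mathcal{B},m)$. Let $Y\subset X$ be a set with positive measure, and let $f:X\to\mathbb{R}$ be an integrable function. Let $B$ be a renormalization function. Assume that $S_n^Yf_Y/B(n/m(Y))$ satisfies an almost sure limit theorem on $Y$, towards a random variable $\mathcal{W}$. Then $S_nf/B(n)$ also satisfies an almost sure limit theorem towards $\mathcal{W}$, on $X$.
   Context: An ergodic endomorphism is an ergodic measure-preserving map. $S_nf=\sum_{k=0}^{n-1}f\circ T^k$. For $y\in Y$, $\phi(y)=\inf\{n>0: T^ny\in Y\}$ is the first return time; $f_Y(y)=\sum_{k=0}^{\phi(y)-1}f(T^ky)$ if $y\in Y$ and $f_Y(y)=0$ if $y\notin Y$. $T_Y:Y\to Y$, $T_Yy=T^{\phi(y)}y$, is the induced map (defined almost everywhere), $m_Y=m(Y)^{-1}m_{|Y}$ is its invariant probability measure, and $S_k^Y$ denotes Birkhoff sums for $T_Y$: $S_k^Yg=\sum_{j=0}^{k-1}g\circ T_Y^j$. A continuous $L:(0,\infty)\to(0,\infty)$ is slowly varying if $L(\lambda x)/L(x)\to1$ as $x\to\infty$ for all $\lambda>0$; it is normalized if it is $C^1$ and $L'(x)=o(L(x)/x)$. A renormalization function is a function $B(x)=x^dL(x)$ on $(0,\infty)$ with $d>0$ and $L$ a normalized slowly varying function. Almost sure limit theorem: $S_n/B_n$ satisfies an almost sure limit theorem towards $\mathcal{W}$ if, for almost all $\omega$, the measures $\frac{1}{\log N}\sum_{k=1}^N\frac1k\delta_{S_k(\omega)/B_k}$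 converge weakly as $N\to\infty$ to the law of $\mathcal{W}$ ($\delta_x$ is the Dirac mass at $x$). On $Y$, "almost all" refers to $m_Y$; on $X$, to $m$. *)

theory Defs
  imports "HOL-Probability.Probability" "HOL-Library.Landau_Symbols"
begin

definition measure_preserving_map :: "'a measure \<Rightarrow> ('a \<Rightarrow> 'a) \<Rightarrow> bool" where
  "measure_preserving_map M T \<longleftrightarrow>
     T \<in> measurable M M \<and> (\<forall>A\<in>sets M. emeasure M (T -` A \<inter> space M) = emeasure M A)"

definition ergodic_endomorphism :: "'a measure \<Rightarrow> ('a \<Rightarrow> 'a) \<Rightarrow> bool" where
  "ergodic_endomorphism M T \<longleftrightarrow>
     measure_preserving_map M T \<and>
     (\<forall>A\<in>sets M. T -` A \<inter> space M = A \<longrightarrow> measure M A = 0 \<or> measure M A = 1)"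

definition birkhoff_sum :: "('a \<Rightarrow> 'a) \<Rightarrow> ('a \<Rightarrow> real) \<Rightarrow> nat \<Rightarrow> 'a \<Rightarrow> real" where
  "birkhoff_sum T f n x = (\<Sum>k<n. f ((T ^^ k) x))"

text \<open>
  If the orbit never returns to \<open>Y\<close>, the infimum is taken over the empty set and is an unspecified
  natural number. By Poincare recurrence, this only concerns a null set of points of \<open>Y\<close>.
\<close>

definition return_time :: "('a \<Rightarrow> 'a) \<Rightarrow> 'a set \<Rightarrow> 'a \<Rightarrow> nat" where
  "return_time T Y y = Inf {n. n > 0 \<and> (T ^^ n) y \<in> Y}"

definition induced_map :: "('a \<Rightarrow> 'a) \<Rightarrow> 'a set \<Rightarrow> 'a \<Rightarrow> 'a" where
  "induced_map T Y y = (T ^^ return_time T Y y) y"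

definition induced_function :: "('a \<Rightarrow> 'a) \<Rightarrow> 'a set \<Rightarrow> ('a \<Rightarrow> real) \<Rightarrow> 'a \<Rightarrow> real" where
  "induced_function T Y f y =
     (if y \<in> Y then (\<Sum>k<return_time T Y y. f ((T ^^ k) y)) else 0)"

definition slowly_varying :: "(real \<Rightarrow> real) \<Rightarrow> bool" where
  "slowly_varying L \<longleftrightarrow>
     continuous_on {0<..} L \<and> (\<forall>x>0. L x > 0) \<and>
     (\<forall>c>0. ((\<lambda>x. L (c * x) / L x) \<longlongrightarrow> 1) at_top)"

definition normalized_slowly_varying :: "(real \<Rightarrow> real) \<Rightarrow> bool" where
  "normalized_slowly_varying L \<longleftrightarrow>
     slowly_varying L \<and> L C1_differentiable_on {0<..} \<and> deriv L \<in> o[at_top](\<lambda>x. L x / x)"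

definition renormalization_function :: "(real \<Rightarrow> real) \<Rightarrow> bool" where
  "renormalization_function B \<longleftrightarrow>
     (\<exists>d>0. \<exists>L. normalized_slowly_varying L \<and> (\<forall>x>0. B x = x powr d * L x))"

text \<open>
  The measure \<open>1 / ln N * (\<Sum>k=1..N. 1 / k * \<delta>(x k))\<close> on the real line, realized as the image under
  \<open>x\<close> of the measure on \<open>{1..N}\<close> with weights \<open>1 / (k * ln N)\<close>.
\<close>

definition log_empirical_measure :: "nat \<Rightarrow> (nat \<Rightarrow> real) \<Rightarrow> real measure" where
  "log_empirical_measure N x =
     distr (point_measure {1..N} (\<lambda>k. ennreal (1 / ln (real N) * (1 / real k)))) borel x"

lemma integral_log_empirical_measure:
  assumes "g \<in> borel_measurable borel"
  shows "(\<integral>z. g z \<partial>log_empirical_measure N x) =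
    1 / ln (real N) * (\<Sum>k=1..N. 1 / real k * (g (x k) :: real))"
proof -
  have "(\<integral>z. g z \<partial>log_empirical_measure N x) =
      (\<integral>k. g (x k) \<partial>point_measure {1..N} (\<lambda>k. ennreal (1 / ln (real N) * (1 / real k))))"
    unfolding log_empirical_measure_def using assms by (intro integral_distr) auto
  also have "\<dots> = (\<Sum>k=1..N. (1 / ln (real N) * (1 / real k)) *\<^sub>R g (x k))"
    by (rule lebesgue_integral_point_measure_finite) auto
  also have "\<dots> = 1 / ln (real N) * (\<Sum>k=1..N. 1 / real k * g (x k))"
    by (simp add: sum_distrib_left mult.assoc)
  finally show ?thesis .
qed

text \<open>
  Weak convergence of finite Borel measures on the line, tested on bounded continuous functions.
  The library's \<open>weak_conv_m\<close> is pointwise convergence of distribution functions, meant for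
  probability measures; the measures \<open>log_empirical_measure N x\<close> have total mass
  \<open>(\<Sum>k=1..N. 1 / k) / ln N\<close>, which only tends to 1.
\<close>

definition weakly_converges :: "(nat \<Rightarrow> real measure) \<Rightarrow> real measure \<Rightarrow> bool" where
  "weakly_converges \<mu> \<nu> \<longleftrightarrow>
     (\<forall>g :: real \<Rightarrow> real. continuous_on UNIV g \<and> bounded (range g) \<longrightarrow>
        (\<lambda>N. \<integral>z. g z \<partial>\<mu> N) \<longlonglongrightarrow> (\<integral>z. g z \<partial>\<nu>))"

text \<open>
  \<open>S\<close> is a sequence of functions on the space of \<open>M\<close>, \<open>b\<close> the normalizing sequence, and the limit
  \<open>W\<close> is a random variable on the possibly different probability space \<open>P\<close>.
\<close>

definition almost_sure_limit_theorem ::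
    "'a measure \<Rightarrow> (nat \<Rightarrow> 'a \<Rightarrow> real) \<Rightarrow> (nat \<Rightarrow> real) \<Rightarrow> 'b measure \<Rightarrow> ('b \<Rightarrow> real) \<Rightarrow> bool" where
  "almost_sure_limit_theorem M S b P W \<longleftrightarrow>
     (AE \<omega> in M. weakly_converges
        (\<lambda>N. log_empirical_measure N (\<lambda>k. S k \<omega> / b k)) (distr P borel W))"

end

theory Submission
  imports Defs
begin

text \<open>
  Sampled at the visits to \<open>Y\<close>, the Birkhoff sums of \<open>f\<close> are those of \<open>f\<^sub>Y\<close> along \<open>T\<^sub>Y\<close>. Since the visits
  have density \<open>m(Y)\<close>, the assumption says that the logarithmic averages of
  \<open>1\<^sub>Y(T\<^sup>nx) g(S\<^sub>nf(x)/B(n))\<close> converge to \<open>m(Y) E g(W)\<close>, for \<open>g\<close> continuous with compact support.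
  The factor \<open>1\<^sub>Y(T\<^sup>nx)\<close> can then be replaced by \<open>m(Y)\<close>: as \<open>B\<close> tends to infinity and is regularly varying,
  \<open>g(S\<^sub>nf(x)/B(n))\<close> hardly changes over a window of fixed length \<open>l\<close>, apart from a set of times of small
  density, whereas the mean of \<open>1\<^sub>Y - m(Y)\<close> over such a window is small in \<open>L\<^sup>1\<close> when \<open>l\<close> is large.
  Compact support of \<open>g\<close> makes \<open>g(c x + e) - g(x)\<close> small uniformly in \<open>x\<close> as \<open>c\<close> tends to 1 and \<open>e\<close> to 0,
  so that no tightness of \<open>S\<^sub>nf/B(n)\<close> is needed in advance.
\<close>

section \<open>The pointwise ergodic theorem\<close>

lemma birkhoff_sum_0 [simp]: "birkhoff_sum T u 0 x = 0"
  by (simp add: birkhoff_sum_def)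

lemma birkhoff_sum_Suc: "birkhoff_sum T u (Suc n) x = u x + birkhoff_sum T u n (T x)"
  unfolding birkhoff_sum_def
  by (simp add: sum.lessThan_Suc_shift funpow_swap1 del: sum.lessThan_Suc)

lemma birkhoff_sum_add:
  "birkhoff_sum T u (k + n) x = birkhoff_sum T u k x + birkhoff_sum T u n ((T ^^ k) x)"
  by (induction k arbitrary: x) (simp_all add: birkhoff_sum_Suc funpow_swap1)

lemma measurable_birkhoff_sum [measurable]:
  assumes [measurable]: "T \<in> measurable M M" "u \<in> borel_measurable M"
  shows "birkhoff_sum T u n \<in> borel_measurable M"
  unfolding birkhoff_sum_def by measurable

lemma measure_preserving_map_distr:
  assumes "measure_preserving_map M T"
  shows "distr M M T = M"
  using assms by (intro measure_eqI) (auto simp: measure_preserving_map_def emeasure_distr)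

lemma integrable_comp_measure_preserving:
  fixes u :: "'a \<Rightarrow> real"
  assumes "measure_preserving_map M T" "integrable M u"
  shows "integrable M (\<lambda>x. u (T x))"
  using assms integrable_distr[of T M M u]
  by (simp add: measure_preserving_map_distr) (simp add: measure_preserving_map_def)

lemma integral_comp_measure_preserving:
  fixes u :: "'a \<Rightarrow> real"
  assumes "measure_preserving_map M T" "u \<in> borel_measurable M"
  shows "(\<integral>x. u (T x) \<partial>M) = (\<integral>x. u x \<partial>M)"
  using assms integral_distr[of T M M u]
  by (simp add: measure_preserving_map_distr) (simp add: measure_preserving_map_def)

text \<open>This is the maximum of the Birkhoff sums of orders 0 to \<open>n\<close>. The recursion
  through \<open>T x\<close> reduces the comparison between order \<open>Suc n\<close> at
  \<open>x\<close> and order \<open>n\<close> at \<open>T x\<close> to unfolding.\<close>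

primrec max_birkhoff_sum :: "('a \<Rightarrow> 'a) \<Rightarrow> ('a \<Rightarrow> real) \<Rightarrow> nat \<Rightarrow> 'a \<Rightarrow> real" where
  "max_birkhoff_sum T u 0 x = 0"
| "max_birkhoff_sum T u (Suc n) x = max 0 (u x + max_birkhoff_sum T u n (T x))"

lemma max_birkhoff_sum_nonneg: "0 \<le> max_birkhoff_sum T u n x"
  by (cases n) auto

lemma max_birkhoff_sum_le_Suc: "max_birkhoff_sum T u n x \<le> max_birkhoff_sum T u (Suc n) x"
proof (induction n arbitrary: x)
  case (Suc n)
  show ?case
    using add_left_mono[OF Suc[of "T x"], of "u x"] max.mono[OF order_refl[of "0 :: real"]] by simp
qed simp

lemma birkhoff_sum_le_max:
  assumes "k \<le> n"
  shows "birkhoff_sum T u k x \<le> max_birkhoff_sum T u n x"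
  using assms
proof (induction n arbitrary: k x)
  case (Suc n)
  note IH = Suc.IH and prems = Suc.prems
  show ?case
  proof (cases k)
    case (Suc j)
    then show ?thesis using IH[of j "T x"] prems by (simp add: birkhoff_sum_Suc le_max_iff_disj)
  qed (simp add: le_max_iff_disj)
qed simp

lemma integrable_max_birkhoff_sum:
  assumes T: "measure_preserving_map M T" and u: "integrable M u"
  shows "integrable M (max_birkhoff_sum T u n)"
proof (induction n)
  case 0
  have "max_birkhoff_sum T u 0 = (\<lambda>x. 0)" by auto
  then show ?case by simp
next
  case (Suc n)
  have "max_birkhoff_sum T u (Suc n) = (\<lambda>x. max 0 (u x + max_birkhoff_sum T u n (T x)))" by auto
  then show ?case
    using u integrable_comp_measure_preserving[OF T Suc] by simp
qed

text \<open>Garsia's maximal inequality, in the limiting form needed here: the increment of the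
  integrals of the maximal sums is the integral of \<open>max (- max_birkhoff_sum T u n \<circ> T) u\<close>, and this
  integrand equals \<open>u\<close> eventually at every point where the sums are unbounded above.\<close>

lemma integral_nonneg_of_unbounded_birkhoff_sum:
  assumes T: "measure_preserving_map M T" and u: "integrable M u"
    and unb: "AE x in M. \<forall>K. \<exists>n. birkhoff_sum T u n (T x) > real K"
  shows "(\<integral>x. u x \<partial>M) \<ge> 0"
proof -
  let ?m = "max_birkhoff_sum T u"
  note im = integrable_max_birkhoff_sum[OF T u]
  note imT = integrable_comp_measure_preserving[OF T im]
  define w where "w n x = max (- ?m n (T x)) (u x)" for n x
  have iw: "integrable M (w n)" for n
    unfolding w_def using u imT by auto
  have pos: "(\<integral>x. w n x \<partial>M) \<ge> 0" for n
  proof -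
    have "(\<integral>x. w n x \<partial>M) = (\<integral>x. ?m (Suc n) x - ?m n (T x) \<partial>M)"
      by (intro Bochner_Integration.integral_cong) (auto simp: w_def max_def)
    also have "\<dots> = (\<integral>x. ?m (Suc n) x \<partial>M) - (\<integral>x. ?m n (T x) \<partial>M)"
      by (rule Bochner_Integration.integral_diff[OF im imT])
    also have "(\<integral>x. ?m n (T x) \<partial>M) = (\<integral>x. ?m n x \<partial>M)"
      using im by (intro integral_comp_measure_preserving[OF T]) auto
    also have "(\<integral>x. ?m (Suc n) x \<partial>M) - \<dots> \<ge> 0"
      using integral_mono[OF im im max_birkhoff_sum_le_Suc] by simp
    finally show ?thesis .
  qed
  have "(\<lambda>n. \<integral>x. w n x \<partial>M) \<longlonglongrightarrow> (\<integral>x. u x \<partial>M)"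
  proof (rule integral_dominated_convergence[where w = "\<lambda>x. \<bar>u x\<bar>"])
    show "AE x in M. (\<lambda>n. w n x) \<longlonglongrightarrow> u x"
      using unb
    proof eventually_elim
      case (elim x)
      obtain k where k: "birkhoff_sum T u k (T x) > real (nat \<lceil>\<bar>u x\<bar>\<rceil>)" using elim by blast
      have "\<forall>\<^sub>F n in sequentially. w n x = u x"
        using eventually_ge_at_top[of k]
      proof eventually_elim
        case (elim n)
        have "\<bar>u x\<bar> \<le> ?m n (T x)"
          using birkhoff_sum_le_max[OF elim, of T u "T x"] k real_nat_ceiling_ge[of "\<bar>u x\<bar>"] by linarith
        then show ?case by (auto simp: w_def)
      qed
      then show ?case by (rule tendsto_eventually)
    qed
    \<comment> \<open>As the maximal sums are nonnegative, truncating \<open>u\<close> from below at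
      a nonpositive level only moves it towards 0.\<close>
    show "AE x in M. norm (w n x) \<le> \<bar>u x\<bar>" for n
    proof (rule AE_I2)
      fix x show "norm (w n x) \<le> \<bar>u x\<bar>"
        using max_birkhoff_sum_nonneg[of T u n "T x"] unfolding w_def by (simp add: max_def)
    qed
  qed (use u iw in auto)
  then show ?thesis by (rule LIMSEQ_le_const) (use pos in auto)
qed

text \<open>Unboundedness above is an invariant property, so it has probability 0 or 1. Probability
  1 would force a nonnegative integral by the preceding inequality.\<close>

lemma ergodic_birkhoff_sum_bounded_above:
  assumes M: "prob_space M" and erg: "ergodic_endomorphism M T" and u: "integrable M u"
    and neg: "(\<integral>x. u x \<partial>M) < 0"
  shows "AE x in M. \<exists>K. \<forall>n. birkhoff_sum T u n x \<le> K"
proof -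
  interpret prob_space M by fact
  have T: "measure_preserving_map M T" and [measurable]: "T \<in> measurable M M"
    using erg by (auto simp: ergodic_endomorphism_def measure_preserving_map_def)
  have [measurable]: "u \<in> borel_measurable M" using u by auto
  define E where "E = {x \<in> space M. \<forall>K. \<exists>n. birkhoff_sum T u n x > real K}"
  have E [measurable]: "E \<in> sets M" unfolding E_def by measurable
  \<comment> \<open>Passing from \<open>x\<close> to \<open>T x\<close> shifts the order by one and
    changes the sums by the single term \<open>u x\<close>, which \<open>C\<close> absorbs. The
    equivalence holds at every point, as the strict invariance in
    \<open>ergodic_endomorphism\<close> demands.\<close>
  have unb: "(\<forall>K. \<exists>n. birkhoff_sum T u n (T x) > real K) \<longleftrightarrow>
      (\<forall>K. \<exists>n. birkhoff_sum T u n x > real K)" (is "?L \<longleftrightarrow> ?R") for x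
  proof
    assume L: ?L
    show ?R
    proof
      fix K
      obtain C where C: "\<bar>u x\<bar> \<le> real C" using real_arch_simple by blast
      obtain n where "birkhoff_sum T u n (T x) > real (K + C)" using L by blast
      then have "birkhoff_sum T u (Suc n) x > K"
        using C by (simp add: birkhoff_sum_Suc)
      then show "\<exists>n. birkhoff_sum T u n x > real K" by blast
    qed
  next
    assume R: ?R
    show ?L
    proof
      fix K
      obtain C where C: "\<bar>u x\<bar> \<le> real C" using real_arch_simple by blast
      obtain n where n: "birkhoff_sum T u n x > real (K + C)" using R by blast
      \<comment> \<open>The order is not 0, since the empty sum does not exceed a natural
        number.\<close>
      then obtain k where "n = Suc k" by (cases n) auto
      then have "birkhoff_sum T u k (T x) > K"
        using n C by (simp add: birkhoff_sum_Suc)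
      then show "\<exists>n. birkhoff_sum T u n (T x) > real K" by blast
    qed
  qed
  have "T -` E \<inter> space M = E"
    using measurable_space[OF \<open>T \<in> measurable M M\<close>] unb by (auto simp: E_def)
  then consider "prob E = 0" | "prob E = 1"
    using erg E unfolding ergodic_endomorphism_def by blast
  then show ?thesis
  proof cases
    case 1
    then have "AE x in M. x \<notin> E" by (simp add: prob_eq_0)
    then show ?thesis
      using AE_space by eventually_elim (force simp: E_def not_less)
  next
    case 2
    then have "AE x in M. x \<in> E" by (simp add: prob_eq_1)
    then have "AE x in M. \<forall>K. \<exists>n. birkhoff_sum T u n (T x) > real K"
      by eventually_elim (auto simp: E_def unb)
    from integral_nonneg_of_unbounded_birkhoff_sum[OF T u this] neg show ?thesis by simp
  qed
qed

text \<open>Lowering \<open>u\<close> by its mean and by a further 1 / (j + 1) makes the integral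
  negative, so the sums become bounded above; dividing by \<open>n\<close> bounds the upper limit.
  The same applied to \<open>- u\<close> bounds the lower limit.\<close>

theorem birkhoff_ergodic:
  assumes M: "prob_space M" and erg: "ergodic_endomorphism M T" and u: "integrable M u"
  shows "AE x in M. (\<lambda>n. birkhoff_sum T u n x / real n) \<longlonglongrightarrow> (\<integral>x. u x \<partial>M)"
proof -
  interpret prob_space M by fact
  let ?I = "\<integral>x. u x \<partial>M"
  have above: "AE x in M. \<forall>j. \<exists>K. \<forall>n. birkhoff_sum T (\<lambda>x. v x - (\<integral>x. v x \<partial>M) - 1 / Suc j) n x \<le> K"
    if v: "integrable M v" for v
    unfolding AE_all_countable
    by (intro allI ergodic_birkhoff_sum_bounded_above[OF M erg]) (use v prob_space in auto)
  have "AE x in M. \<forall>j. \<exists>K. \<forall>n. birkhoff_sum T (\<lambda>x. - u x - (\<integral>x. - u x \<partial>M) - 1 / Suc j) n x \<le> K"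
    using u by (intro above) auto
  with above[OF u] show ?thesis
  proof eventually_elim
    case (elim x)
    show ?case
    proof (rule LIMSEQ_I)
      fix r :: real assume "r > 0"
      then obtain j where j: "1 / real (Suc j) < r / 2"
        using nat_approx_posE[of "r / 2"] by auto
      obtain K1 where K1: "\<And>n. birkhoff_sum T (\<lambda>x. u x - ?I - 1 / Suc j) n x \<le> K1"
        using elim(1) by blast
      obtain K2 where K2: "\<And>n. birkhoff_sum T (\<lambda>x. - u x - (\<integral>x. - u x \<partial>M) - 1 / Suc j) n x \<le> K2"
        using elim(2) by blast
      define K where "K = max (max K1 K2) 0"
      obtain n0 where n0: "real n0 > 2 * K / r" using reals_Archimedean2 by blast
      show "\<exists>no. \<forall>n\<ge>no. norm (birkhoff_sum T u n x / real n - ?I) < r"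
      proof (intro exI[of _ "Suc n0"] allI impI)
        fix n assume n: "Suc n0 \<le> n"
        have 1: "birkhoff_sum T u n x - n * ?I - n / Suc j \<le> K"
          using K1[of n] by (simp add: birkhoff_sum_def sum.distrib sum_subtractf K_def)
        have 2: "- birkhoff_sum T u n x + n * ?I - n / Suc j \<le> K"
          using K2[of n] by (simp add: birkhoff_sum_def sum.distrib sum_subtractf sum_negf K_def)
        have "real n > 2 * K / r" using n n0 by linarith
        then have 3: "K < n * (r / 2)" using \<open>r > 0\<close> by (simp add: field_simps)
        have "real n * (1 / Suc j) \<le> n * (r / 2)" using j by (intro mult_left_mono) auto
        then have "\<bar>birkhoff_sum T u n x - n * ?I\<bar> < n * r" using 1 2 3 by (simp add: abs_less_iff)
        moreover have "birkhoff_sum T u n x / real n - ?I = (birkhoff_sum T u n x - n * ?I) / n"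
          using n by (simp add: field_simps)
        ultimately show "norm (birkhoff_sum T u n x / real n - ?I) < r"
          using n by (simp add: abs_divide field_simps)
      qed
    qed
  qed
qed

section \<open>Logarithmic averages\<close>

text \<open>For \<open>u k = g (x k)\<close> this is the integral of the test function
  \<open>g\<close> against \<open>log_empirical_measure N x\<close>.\<close>

definition log_average :: "(nat \<Rightarrow> real) \<Rightarrow> nat \<Rightarrow> real" where
  "log_average u N = 1 / ln (real N) * (\<Sum>k=1..N. 1 / real k * u k)"

lemma log_average_add: "log_average (\<lambda>n. u n + v n) N = log_average u N + log_average v N"
  by (simp add: log_average_def sum.distrib distrib_left add_divide_distrib)

lemma log_average_diff: "log_average (\<lambda>n. u n - v n) N = log_average u N - log_average v N"
  by (simp add: log_average_def sum_subtractf right_diff_distrib diff_divide_distrib)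

lemma log_average_cmult: "log_average (\<lambda>n. c * u n) N = c * log_average u N"
  by (simp add: log_average_def sum_distrib_left mult_ac)

lemma log_average_sum:
  "finite I \<Longrightarrow> log_average (\<lambda>n. \<Sum>i\<in>I. u i n) N = (\<Sum>i\<in>I. log_average (u i) N)"
  by (induction rule: finite_induct) (simp_all add: log_average_add, simp add: log_average_def)

lemma log_average_mono:
  assumes "\<And>k. u k \<le> v k"
  shows "log_average u N \<le> log_average v N"
proof (cases "N = 0")
  case False
  then show ?thesis
    unfolding log_average_def using assms
    by (intro mult_left_mono sum_mono) (auto intro: divide_right_mono)
qed (simp add: log_average_def)

lemma abs_log_average_le:
  assumes "\<And>k. \<bar>u k\<bar> \<le> v k"
  shows "\<bar>log_average u N\<bar> \<le> log_average v N"
proof -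
  have "log_average u N \<le> log_average v N"
    using assms by (intro log_average_mono) (auto simp: abs_le_iff)
  moreover have "log_average (\<lambda>k. - 1 * u k) N \<le> log_average v N"
    using assms by (intro log_average_mono) (auto simp: abs_le_iff)
  ultimately show ?thesis unfolding log_average_cmult by simp
qed

lemma ln_real_at_top: "filterlim (\<lambda>N. ln (real N)) at_top sequentially"
  by (rule filterlim_compose[OF ln_at_top filterlim_real_sequentially])

text \<open>The harmonic sum minus \<open>ln N\<close> converges to Euler's constant, and division
  by \<open>ln N\<close> removes the difference.\<close>

lemma log_average_1: "log_average (\<lambda>_. 1) \<longlonglongrightarrow> 1"
proof -
  have "(\<lambda>N. (harm N - ln (real N)) / ln (real N) + 1) \<longlonglongrightarrow> 0 + 1"
    by (intro tendsto_add tendsto_const real_tendsto_divide_at_top[OF euler_mascheroni_LIMSEQ] ln_real_at_top)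
  moreover have "\<forall>\<^sub>F N in sequentially.
      (harm N - ln (real N)) / ln (real N) + 1 = log_average (\<lambda>_. 1) N"
    using eventually_ge_at_top[of 2]
    by eventually_elim (simp add: log_average_def harm_def field_simps)
  ultimately show ?thesis by (simp add: filterlim_cong)
qed

lemma log_average_eventually_0:
  assumes "\<forall>\<^sub>F n in sequentially. u n = 0"
  shows "log_average u \<longlonglongrightarrow> 0"
proof -
  obtain n0 where n0: "\<And>n. n \<ge> n0 \<Longrightarrow> u n = 0"
    using assms by (auto simp: eventually_sequentially)
  have "(\<lambda>N. (\<Sum>k=1..n0. 1 / real k * u k) / ln (real N)) \<longlonglongrightarrow> 0"
    by (intro real_tendsto_divide_at_top[OF tendsto_const] ln_real_at_top)
  moreover have "\<forall>\<^sub>F N in sequentially. (\<Sum>k=1..n0. 1 / real k * u k) / ln (real N) = log_average u N"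
    using eventually_ge_at_top[of n0]
  proof eventually_elim
    case (elim N)
    have "(\<Sum>k=1..N. 1 / real k * u k) = (\<Sum>k=1..n0. 1 / real k * u k)"
      using n0 elim by (intro sum.mono_neutral_right) auto
    then show ?case by (simp add: log_average_def)
  qed
  ultimately show ?thesis by (simp add: filterlim_cong)
qed

text \<open>The dominating sequence may depend on \<open>e\<close>, and its averages need only have
  a limit below \<open>e\<close>. This admits error terms that are small without vanishing.\<close>

lemma log_average_tendsto_0I:
  assumes "\<And>e. e > 0 \<Longrightarrow> \<exists>v c. (\<forall>\<^sub>F n in sequentially. \<bar>u n\<bar> \<le> v n) \<and> log_average v \<longlonglongrightarrow> c \<and> c < e"
  shows "log_average u \<longlonglongrightarrow> 0"
proof (rule tendstoI)
  fix e :: real assume "e > 0"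
  then obtain v c where v: "\<forall>\<^sub>F n in sequentially. \<bar>u n\<bar> \<le> v n" "log_average v \<longlonglongrightarrow> c" "c < e"
    using assms by blast
  \<comment> \<open>\<open>r\<close> is the excess at the finitely many indices where the bound
    fails; adding it makes the domination hold everywhere, as \<open>abs_log_average_le\<close>
    requires.\<close>
  define r where "r n = max 0 (\<bar>u n\<bar> - v n)" for n
  have "log_average r \<longlonglongrightarrow> 0"
    using v(1) by (intro log_average_eventually_0) (auto simp: r_def elim: eventually_mono)
  with v(2) have "(\<lambda>N. log_average v N + log_average r N) \<longlonglongrightarrow> c + 0" by (rule tendsto_add)
  then have "\<forall>\<^sub>F N in sequentially. log_average v N + log_average r N < e"
    using v(3) by (intro order_tendstoD) auto
  then show "\<forall>\<^sub>F N in sequentially. dist (log_average u N) 0 < e"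
  proof eventually_elim
    case (elim N)
    have "\<bar>log_average u N\<bar> \<le> log_average (\<lambda>n. v n + r n) N"
      by (rule abs_log_average_le) (auto simp: r_def)
    then show ?case using elim by (simp add: log_average_add)
  qed
qed

lemma log_average_dominated_0:
  assumes "log_average v \<longlonglongrightarrow> 0" "\<forall>\<^sub>F n in sequentially. \<bar>u n\<bar> \<le> v n"
  shows "log_average u \<longlonglongrightarrow> 0"
  using assms by (intro log_average_tendsto_0I) blast

lemma log_average_tendsto:
  assumes "u \<longlonglongrightarrow> a"
  shows "log_average u \<longlonglongrightarrow> a"
proof -
  have "log_average (\<lambda>n. u n - a) \<longlonglongrightarrow> 0"
  proof (rule log_average_tendsto_0I)
    fix e :: real assume e: "e > 0"
    have "(\<lambda>N. (e / 2) * log_average (\<lambda>_. 1) N) \<longlonglongrightarrow> (e / 2) * 1"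
      by (intro tendsto_mult tendsto_const log_average_1)
    then have "log_average (\<lambda>_. (e / 2) * 1) \<longlonglongrightarrow> (e / 2) * 1"
      unfolding log_average_cmult .
    moreover have "\<forall>\<^sub>F n in sequentially. \<bar>u n - a\<bar> \<le> (e / 2) * 1"
      using tendstoD[OF assms, of "e / 2"] e by (auto simp: dist_real_def elim: eventually_mono)
    ultimately show "\<exists>v c. (\<forall>\<^sub>F n in sequentially. \<bar>u n - a\<bar> \<le> v n) \<and> log_average v \<longlonglongrightarrow> c \<and> c < e"
      using e by (intro exI[of _ "\<lambda>_. (e / 2) * 1"] exI[of _ "(e / 2) * 1"]) auto
  qed
  moreover have "(\<lambda>N. a * log_average (\<lambda>_. 1) N) \<longlonglongrightarrow> a * 1"
    by (intro tendsto_mult tendsto_const log_average_1)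
  ultimately have "(\<lambda>N. log_average (\<lambda>n. u n - a) N + a * log_average (\<lambda>_. 1) N) \<longlonglongrightarrow> 0 + a * 1"
    by (rule tendsto_add)
  moreover have "log_average (\<lambda>n. u n - a) N + a * log_average (\<lambda>_. 1) N = log_average u N" for N
    unfolding log_average_cmult[symmetric] log_average_add[symmetric] by simp
  ultimately show ?thesis by simp
qed

text \<open>Summation by parts exhibits the logarithmic average of a sequence as that of its
  Cesaro means, up to a bounded term.\<close>

lemma log_average_tendsto_of_cesaro:
  assumes "(\<lambda>n. (\<Sum>k<n. u k) / real n) \<longlonglongrightarrow> a"
  shows "log_average u \<longlonglongrightarrow> a"
proof -
  \<comment> \<open>The mean includes index \<open>n\<close>, so it never divides by 0, and the
    boundary terms of the summation by parts are \<open>A N\<close> and \<open>u 0\<close>.\<close>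
  define A where "A n = (\<Sum>k<Suc n. u k) / real (Suc n)" for n
  have A: "A \<longlonglongrightarrow> a"
    using LIMSEQ_Suc[OF assms] unfolding A_def .
  have *: "(\<Sum>k=1..N. 1 / real k * u k) = A N - u 0 + (\<Sum>k=1..N. 1 / real k * A k)" for N
  proof (induction N)
    case (Suc N)
    define S where "S = (\<Sum>k<Suc N. u k)"
    have "A N + 1 / real (Suc N) * u (Suc N) = A (Suc N) + 1 / real (Suc N) * A (Suc N)"
    proof -
      define x where "x = real (Suc N)"
      have x: "x > 0" "real (Suc (Suc N)) = x + 1" by (simp_all add: x_def)
      have *: "y / (x + 1) + 1 / x * (y / (x + 1)) = y / x" for y
        using x(1) by (simp add: divide_simps) (simp add: algebra_simps)
      then show ?thesis
        unfolding A_def sum.lessThan_Suc[of u "Suc N"] S_def[symmetric] x(2) x_def[symmetric]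
        by (simp only: *) (simp add: add_divide_distrib)
    qed
    with Suc show ?case by simp
  qed (simp add: A_def)
  have "log_average u = (\<lambda>N. (A N - u 0) / ln (real N) + log_average A N)"
    unfolding fun_eq_iff log_average_def * by (simp add: add_divide_distrib)
  moreover have "(\<lambda>N. (A N - u 0) / ln (real N) + log_average A N) \<longlonglongrightarrow> 0 + a"
    by (intro tendsto_add real_tendsto_divide_at_top[OF tendsto_diff[OF A tendsto_const]]
        ln_real_at_top log_average_tendsto A)
  ultimately show ?thesis by simp
qed

text \<open>A shift by one telescopes in the Cesaro means, where it leaves a bounded term divided by
  \<open>n\<close>. Longer shifts are compositions of shifts by one.\<close>

lemma log_average_shift:
  assumes "\<And>n. \<bar>u n\<bar> \<le> C"
  shows "log_average (\<lambda>n. u (n + i) - u n) \<longlonglongrightarrow> 0"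
proof (induction i)
  case 0
  then show ?case by (simp add: log_average_def)
next
  case (Suc i)
  have "log_average (\<lambda>n. u (Suc n + i) - u (n + i)) \<longlonglongrightarrow> 0"
  proof (rule log_average_tendsto_of_cesaro)
    have "(\<Sum>k<n. u (Suc k + i) - u (k + i)) = u (n + i) - u i" for n
      using sum_lessThan_telescope[of "\<lambda>k. u (k + i)" n] by simp
    moreover have "(\<lambda>n. (u (n + i) - u i) / real n) \<longlonglongrightarrow> 0"
    proof (rule Lim_null_comparison)
      show "(\<lambda>n. (2 * C) / real n) \<longlonglongrightarrow> 0"
        by (intro real_tendsto_divide_at_top[OF tendsto_const] filterlim_real_sequentially)
      have "\<bar>u (n + i) - u i\<bar> \<le> 2 * C" for n
        using assms[of "n + i"] assms[of i] by linarith
      then show "\<forall>\<^sub>F n in sequentially. norm ((u (n + i) - u i) / real n) \<le> 2 * C / real n"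
        by (intro always_eventually allI) (simp add: divide_right_mono)
    qed
    ultimately show "(\<lambda>n. (\<Sum>k<n. u (Suc k + i) - u (k + i)) / real n) \<longlonglongrightarrow> 0" by simp
  qed
  from tendsto_add[OF this Suc] show ?case
    unfolding log_average_add[symmetric] by simp
qed

text \<open>If \<open>b\<close> varies slowly, then \<open>\<psi>\<close> may be replaced by its averages over windows of fixed length.\<close>

lemma log_average_mult_tendsto_0:
  assumes b: "\<And>n. \<bar>b n\<bar> \<le> C" and \<psi>: "\<And>n. \<bar>\<psi> n\<bar> \<le> 1"
    and slow: "log_average (\<lambda>n. \<bar>b (Suc n) - b n\<bar>) \<longlonglongrightarrow> 0"
    and mean: "\<And>e. e > 0 \<Longrightarrow> \<exists>l>0. \<exists>c<e. log_average (\<lambda>n. \<bar>(\<Sum>i<l. \<psi> (n + i)) / real l\<bar>) \<longlonglongrightarrow> c"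
  shows "log_average (\<lambda>n. b n * \<psi> n) \<longlonglongrightarrow> 0"
proof -
  have C: "C \<ge> 0" using b[of 0] by linarith
  \<comment> \<open>Between \<open>n\<close> and \<open>n + i\<close> there are \<open>i\<close>
    increments of \<open>b\<close>. By \<open>log_average_shift\<close>, looking at an increment at
    a later time does not affect its limiting average 0.\<close>
  have slow_i: "log_average (\<lambda>n. \<bar>b (n + i) - b n\<bar>) \<longlonglongrightarrow> 0" for i
  proof (induction i)
    case 0
    then show ?case by (simp add: log_average_def)
  next
    case (Suc i)
    have "\<bar>\<bar>b (Suc n) - b n\<bar>\<bar> \<le> 2 * C" for n
      using b[of n] b[of "Suc n"] by linarith
    from tendsto_add[OF log_average_shift[where u = "\<lambda>n. \<bar>b (Suc n) - b n\<bar>" and i = i, OF this] slow]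
    have "log_average (\<lambda>n. \<bar>b (Suc (n + i)) - b (n + i)\<bar>) \<longlonglongrightarrow> 0"
      unfolding log_average_add[symmetric] by simp
    from tendsto_add[OF this Suc]
    have "log_average (\<lambda>n. \<bar>b (Suc (n + i)) - b (n + i)\<bar> + \<bar>b (n + i) - b n\<bar>) \<longlonglongrightarrow> 0"
      unfolding log_average_add by simp
    then show ?case
      by (rule log_average_dominated_0) (auto intro!: always_eventually)
  qed
  \<comment> \<open>The whole product \<open>b n * \<psi> n\<close> is shifted by \<open>i\<close>;
    then \<open>b (n + i)\<close> is turned back into \<open>b n\<close>, at a cost controlled by
    \<open>slow_i\<close>.\<close>
  have step: "log_average (\<lambda>n. b n * \<psi> n - b n * \<psi> (n + i)) \<longlonglongrightarrow> 0" for i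
  proof -
    have "\<bar>b n * \<psi> n\<bar> \<le> C" for n
      using mult_mono[OF b[of n] \<psi>[of n]] C by (simp add: abs_mult)
    then have 1: "log_average (\<lambda>n. b (n + i) * \<psi> (n + i) - b n * \<psi> n) \<longlonglongrightarrow> 0"
      by (rule log_average_shift)
    have 2: "log_average (\<lambda>n. (b (n + i) - b n) * \<psi> (n + i)) \<longlonglongrightarrow> 0"
      using slow_i[of i]
    proof (rule log_average_dominated_0, intro always_eventually allI)
      fix n show "\<bar>(b (n + i) - b n) * \<psi> (n + i)\<bar> \<le> \<bar>b (n + i) - b n\<bar>"
        using mult_left_mono[OF \<psi>[of "n + i"], of "\<bar>b (n + i) - b n\<bar>"] by (simp add: abs_mult)
    qed
    from tendsto_diff[OF 2 1] show ?thesis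
      unfolding log_average_diff[symmetric] by (simp add: algebra_simps)
  qed
  show ?thesis
  proof (rule tendstoI)
    fix e :: real assume e: "e > 0"
    \<comment> \<open>Half of \<open>e\<close> is for the window means and half for replacing
      \<open>\<psi>\<close> by them. \<open>C + 1\<close> keeps the quotient meaningful when
      \<open>C = 0\<close>.\<close>
    then obtain l c where l: "l > 0" and c: "c < e / (2 * (C + 1))"
      and lim: "log_average (\<lambda>n. \<bar>(\<Sum>i<l. \<psi> (n + i)) / real l\<bar>) \<longlonglongrightarrow> c"
      using mean[of "e / (2 * (C + 1))"] C by auto
    define \<Psi> where "\<Psi> n = (\<Sum>i<l. \<psi> (n + i)) / real l" for n
    have "(\<lambda>N. 1 / real l * (\<Sum>i<l. log_average (\<lambda>n. b n * \<psi> n - b n * \<psi> (n + i)) N)) \<longlonglongrightarrow>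
        1 / real l * (\<Sum>i<l. 0)"
      by (intro tendsto_mult tendsto_const tendsto_sum step)
    moreover have "1 / real l * (\<Sum>i<l. b n * \<psi> n - b n * \<psi> (n + i)) = b n * \<psi> n - b n * \<Psi> n" for n
      using l by (simp add: \<Psi>_def sum_subtractf sum_distrib_left[symmetric] field_simps)
    ultimately have "log_average (\<lambda>n. b n * \<psi> n - b n * \<Psi> n) \<longlonglongrightarrow> 0"
      unfolding log_average_sum[OF finite_lessThan, symmetric] log_average_cmult[symmetric] by simp
    then have "\<forall>\<^sub>F N in sequentially. \<bar>log_average (\<lambda>n. b n * \<psi> n - b n * \<Psi> n) N\<bar> < e / 2"
      using e tendstoD[of "log_average (\<lambda>n. b n * \<psi> n - b n * \<Psi> n)" 0 sequentially "e / 2"]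
      by (simp add: dist_real_def)
    moreover have "\<forall>\<^sub>F N in sequentially. log_average (\<lambda>n. \<bar>\<Psi> n\<bar>) N < e / (2 * (C + 1))"
      using order_tendstoD(2)[OF lim c] by (simp add: \<Psi>_def)
    ultimately show "\<forall>\<^sub>F N in sequentially. dist (log_average (\<lambda>n. b n * \<psi> n) N) 0 < e"
    proof eventually_elim
      case (elim N)
      have "\<bar>log_average (\<lambda>n. b n * \<Psi> n) N\<bar> \<le> log_average (\<lambda>n. (C + 1) * \<bar>\<Psi> n\<bar>) N"
      proof (rule abs_log_average_le)
        fix n show "\<bar>b n * \<Psi> n\<bar> \<le> (C + 1) * \<bar>\<Psi> n\<bar>"
          using b[of n] unfolding abs_mult by (intro mult_right_mono) auto
      qed
      also have "\<dots> = (C + 1) * log_average (\<lambda>n. \<bar>\<Psi> n\<bar>) N" by (rule log_average_cmult)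
      also have "\<dots> < (C + 1) * (e / (2 * (C + 1)))"
        using elim(2) C by (intro mult_strict_left_mono) auto
      also have "\<dots> = e / 2" using C by (simp add: field_simps)
      finally show ?case
        using elim(1) unfolding log_average_diff dist_real_def by linarith
    qed
  qed
qed

section \<open>Renormalization functions\<close>

text \<open>Since \<open>L\<close> is normalized, \<open>x\<close> times the logarithmic derivative
  of \<open>B\<close> tends to the exponent of \<open>B\<close>. With \<open>d\<close> half that
  exponent, it eventually lies between \<open>d\<close> and \<open>3 * d\<close>.\<close>

lemma renormalization_function_ln_bounds:
  assumes "renormalization_function B"
  obtains d x0 where "d > 0" "x0 > 0" "\<And>x. x > 0 \<Longrightarrow> B x > 0"
    and "\<And>x y. x0 \<le> x \<Longrightarrow> x \<le> y \<Longrightarrow> d * (ln y - ln x) \<le> ln (B y) - ln (B x)"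
    and "\<And>x y. x0 \<le> x \<Longrightarrow> x \<le> y \<Longrightarrow> ln (B y) - ln (B x) \<le> 3 * d * (ln y - ln x)"
proof -
  obtain d' L where d': "d' > 0" and L: "normalized_slowly_varying L"
    and B: "\<And>x. x > 0 \<Longrightarrow> B x = x powr d' * L x"
    using assms by (auto simp: renormalization_function_def)
  define d where "d = d' / 2"
  have d: "d > 0" "d' = 2 * d" using d' by (auto simp: d_def)
  have Lpos: "L x > 0" if "x > 0" for x
    using L that by (auto simp: normalized_slowly_varying_def slowly_varying_def)
  have L': "(L has_real_derivative deriv L x) (at x)" if "x > 0" for x
    using L that
    by (auto simp: normalized_slowly_varying_def C1_differentiable_on_eq DERIV_deriv_iff_real_differentiable)
  have "\<forall>\<^sub>F x in at_top. norm (deriv L x) \<le> d * norm (L x / x)"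
    using L d(1) by (intro landau_o.smallD) (auto simp: normalized_slowly_varying_def)
  then obtain x1 where x1: "\<And>x. x \<ge> x1 \<Longrightarrow> norm (deriv L x) \<le> d * norm (L x / x)"
    by (auto simp: eventually_at_top_linorder)
  define x0 where "x0 = max 1 x1"
  have lnB: "ln (B x) = 2 * d * ln x + ln (L x)" if "x > 0" for x
    using B[OF that] Lpos[OF that] that by (simp add: ln_mult ln_powr d)
  have D: "((\<lambda>x. s * d * ln x + r * ln (L x)) has_real_derivative (s * d / x + r * (deriv L x / L x))) (at x)"
    if "x > 0" for x s r :: real
    using that L'[OF that] Lpos[OF that] by (auto intro!: derivative_eq_intros simp: field_simps)
  have bd: "\<bar>deriv L x / L x\<bar> \<le> d / x" if "x \<ge> x0" for x
  proof -
    have "x > 0" "x \<ge> x1" using that by (auto simp: x0_def)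
    then show ?thesis using x1[of x] Lpos[of x] by (simp add: abs_divide field_simps)
  qed
  \<comment> \<open>By \<open>bd\<close>, both \<open>d * ln x + ln (L x)\<close> and
    \<open>d * ln x - ln (L x)\<close> are nondecreasing past \<open>x0\<close>. As
    \<open>ln (B x)\<close> is \<open>2 * d * ln x + ln (L x)\<close>, the first fact gives the
    lower bound and the second the upper bound.\<close>
  have "ln (L x) + d * ln x \<le> ln (L y) + d * ln y" if "x0 \<le> x" "x \<le> y" for x y
  proof -
    have "1 * d * ln x + 1 * ln (L x) \<le> 1 * d * ln y + 1 * ln (L y)"
      using that(2)
    proof (rule DERIV_nonneg_imp_nondecreasing)
      fix z assume z: "x \<le> z" "z \<le> y"
      then have "z > 0" "z \<ge> x0" using that by (auto simp: x0_def)
      then show "\<exists>w. ((\<lambda>x. 1 * d * ln x + 1 * ln (L x)) has_real_derivative w) (at z) \<and> 0 \<le> w"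
        using D[of z 1 1] bd[of z] by (intro exI conjI) (assumption, linarith)
    qed
    then show ?thesis by simp
  qed
  note incr = this
  have "d * ln x - ln (L x) \<le> d * ln y - ln (L y)" if "x0 \<le> x" "x \<le> y" for x y
  proof -
    have "1 * d * ln x + (-1) * ln (L x) \<le> 1 * d * ln y + (-1) * ln (L y)"
      using that(2)
    proof (rule DERIV_nonneg_imp_nondecreasing)
      fix z assume z: "x \<le> z" "z \<le> y"
      then have "z > 0" "z \<ge> x0" using that by (auto simp: x0_def)
      then show "\<exists>w. ((\<lambda>x. 1 * d * ln x + (-1) * ln (L x)) has_real_derivative w) (at z) \<and> 0 \<le> w"
        using D[of z 1 "-1"] bd[of z] by (intro exI conjI) (assumption, linarith)
    qed
    then show ?thesis by simp
  qed
  note decr = this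
  show ?thesis
  proof (rule that[of d x0])
    show "d > 0" "x0 > 0" "\<And>x. x > 0 \<Longrightarrow> B x > 0" using d(1) B Lpos by (auto simp: x0_def)
    fix x y assume xy: "x0 \<le> x" "x \<le> y"
    then have "x > 0" "y > 0" by (auto simp: x0_def)
    then show "d * (ln y - ln x) \<le> ln (B y) - ln (B x)" "ln (B y) - ln (B x) \<le> 3 * d * (ln y - ln x)"
      using incr[OF xy] decr[OF xy] by (simp_all add: lnB right_diff_distrib)
  qed
qed

lemma renormalization_function_pos:
  "renormalization_function B \<Longrightarrow> x > 0 \<Longrightarrow> B x > 0"
  using renormalization_function_ln_bounds by metis

text \<open>With \<open>x0\<close> as base point, the lower logarithmic bound makes
  \<open>ln (B y)\<close> grow at least like \<open>d * ln y\<close>.\<close>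

lemma renormalization_function_at_top:
  assumes B: "renormalization_function B"
  shows "filterlim B at_top at_top"
proof -
  obtain d x0 where d: "d > 0" and x0: "x0 > 0" and pos: "\<And>x. x > 0 \<Longrightarrow> B x > 0"
    and lower: "\<And>x y. x0 \<le> x \<Longrightarrow> x \<le> y \<Longrightarrow> d * (ln y - ln x) \<le> ln (B y) - ln (B x)"
    using renormalization_function_ln_bounds[OF B] by metis
  have "filterlim (\<lambda>y. d * ln y) at_top at_top"
    using d by (intro filterlim_tendsto_pos_mult_at_top[OF tendsto_const] ln_at_top)
  then have "filterlim (\<lambda>y. (ln (B x0) - d * ln x0) + d * ln y) at_top at_top"
    by (intro filterlim_tendsto_add_at_top[OF tendsto_const])
  then have "filterlim (\<lambda>y. ln (B y)) at_top at_top"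
    by (rule filterlim_at_top_mono)
       (use lower[OF order_refl] in \<open>auto simp: eventually_at_top_linorder algebra_simps intro!: exI[of _ x0]\<close>)
  then have "filterlim (\<lambda>y. exp (ln (B y))) at_top at_top"
    by (rule filterlim_compose[OF exp_at_top])
  moreover have "\<forall>\<^sub>F y in at_top. exp (ln (B y)) = B y"
    using eventually_gt_at_top[of 0] by eventually_elim (simp add: pos)
  ultimately show ?thesis by (simp add: filterlim_cong)
qed

text \<open>Past \<open>x0\<close>, \<open>ln (B x)\<close> is a Lipschitz function of
  \<open>ln x\<close>. Hence the factor between the arguments may vary with \<open>n\<close>, as it
  does for visit counts.\<close>

lemma renormalization_function_ratio:
  assumes B: "renormalization_function B"
    and v: "filterlim v at_top F" and uv: "((\<lambda>n. u n / v n) \<longlongrightarrow> 1) F"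
  shows "((\<lambda>n. B (u n) / B (v n)) \<longlongrightarrow> 1) F"
proof -
  obtain d x0 where d: "d > 0" and x0: "x0 > 0" and pos: "\<And>x. x > 0 \<Longrightarrow> B x > 0"
    and lower: "\<And>x y. x0 \<le> x \<Longrightarrow> x \<le> y \<Longrightarrow> d * (ln y - ln x) \<le> ln (B y) - ln (B x)"
    and upper: "\<And>x y. x0 \<le> x \<Longrightarrow> x \<le> y \<Longrightarrow> ln (B y) - ln (B x) \<le> 3 * d * (ln y - ln x)"
    using renormalization_function_ln_bounds[OF B] by metis
  have mono: "0 \<le> d * (ln y - ln x)" if "x0 \<le> x" "x \<le> y" for x y
    using that d x0 by simp
  have lip: "\<bar>ln (B x) - ln (B y)\<bar> \<le> 3 * d * \<bar>ln x - ln y\<bar>" if "x0 \<le> x" "x0 \<le> y" for x y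
  proof (cases "x \<le> y")
    case True
    then show ?thesis using lower[of x y] upper[of x y] mono[of x y] that x0 by simp
  next
    case False
    then show ?thesis using lower[of y x] upper[of y x] mono[of y x] that x0 by simp
  qed
  have "((\<lambda>n. ln (u n / v n)) \<longlongrightarrow> ln 1) F" by (rule tendsto_ln[OF uv]) simp
  then have "((\<lambda>n. 3 * d * \<bar>ln (u n / v n)\<bar>) \<longlongrightarrow> 3 * d * \<bar>ln 1\<bar>) F"
    by (intro tendsto_mult tendsto_const tendsto_rabs)
  then have lim: "((\<lambda>n. 3 * d * \<bar>ln (u n / v n)\<bar>) \<longlongrightarrow> 0) F" by simp
  \<comment> \<open>Only \<open>v\<close> is assumed to diverge; \<open>u\<close> is eventually at
    least half of \<open>v\<close>.\<close>
  have large: "\<forall>\<^sub>F n in F. x0 \<le> u n \<and> x0 \<le> v n"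
  proof -
    have "\<forall>\<^sub>F n in F. u n / v n > 1 / 2" using uv by (rule order_tendstoD) auto
    moreover have "\<forall>\<^sub>F n in F. v n \<ge> 2 * x0" using v by (auto simp: filterlim_at_top)
    ultimately show ?thesis
    proof eventually_elim
      case (elim n)
      then have "v n > 0" using x0 by linarith
      with elim x0 show ?case by (simp add: field_simps)
    qed
  qed
  have "((\<lambda>n. ln (B (u n)) - ln (B (v n))) \<longlongrightarrow> 0) F"
  proof (rule Lim_null_comparison[OF _ lim])
    show "\<forall>\<^sub>F n in F. norm (ln (B (u n)) - ln (B (v n))) \<le> 3 * d * \<bar>ln (u n / v n)\<bar>"
      using large by eventually_elim (use x0 lip in \<open>simp add: ln_div\<close>)
  qed
  then have "((\<lambda>n. exp (ln (B (u n)) - ln (B (v n)))) \<longlongrightarrow> exp 0) F"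
    by (rule tendsto_exp)
  moreover have "\<forall>\<^sub>F n in F. exp (ln (B (u n)) - ln (B (v n))) = B (u n) / B (v n)"
    using large
  proof eventually_elim
    case (elim n)
    then have "B (u n) > 0" "B (v n) > 0" using x0 pos by auto
    then show ?case by (simp add: exp_diff)
  qed
  ultimately show ?thesis by (simp add: filterlim_cong)
qed

section \<open>Compactly supported test functions under small affine changes\<close>

lemma compact_support_affine_continuity:
  fixes g :: "real \<Rightarrow> real"
  assumes g: "continuous_on UNIV g" and supp: "\<And>x. \<bar>x\<bar> > R \<Longrightarrow> g x = 0" and "R \<ge> 0" and "\<eta> > 0"
  obtains \<delta> where "\<delta> > 0"
    and "\<And>x c e. \<bar>c - 1\<bar> \<le> \<delta> \<Longrightarrow> \<bar>e\<bar> \<le> \<delta> \<Longrightarrow> \<bar>g (c * x + e) - g x\<bar> < \<eta>"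
proof -
  \<comment> \<open>For \<open>\<bar>x\<bar> \<le> r\<close> uniform continuity applies. For larger
    \<open>x\<close>, \<open>\<bar>c\<bar> \<ge> 1 / 2\<close> and
    \<open>\<bar>e\<bar> \<le> 1 / 2\<close> give \<open>\<bar>c * x + e\<bar> > R\<close>, so both
    values of \<open>g\<close> vanish.\<close>
  define r where "r = 2 * R + 2"
  have r: "r > 0" and r1: "r \<ge> 1" using assms by (simp_all add: r_def)
  have "uniformly_continuous_on {- 2 * r..2 * r} g"
    by (intro compact_uniformly_continuous continuous_on_subset[OF g]) auto
  then obtain \<delta>0 where \<delta>0: "\<delta>0 > 0"
    and uc: "\<And>x y. \<bar>x\<bar> \<le> 2 * r \<Longrightarrow> \<bar>y\<bar> \<le> 2 * r \<Longrightarrow> \<bar>x - y\<bar> < \<delta>0 \<Longrightarrow> \<bar>g x - g y\<bar> < \<eta>"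
    using \<open>\<eta> > 0\<close> unfolding uniformly_continuous_on_def dist_real_def
    by (metis abs_le_iff atLeastAtMost_iff minus_le_iff mult_minus_left)
  \<comment> \<open>For \<open>\<bar>x\<bar> \<le> r\<close> the displacement is at most
    \<open>\<delta> * (r + 1)\<close>; the cap 1 / 2 keeps the moved point within
    \<open>2 * r\<close>.\<close>
  define \<delta> where "\<delta> = min (1 / 2) (\<delta>0 / (2 * (r + 1)))"
  have \<delta>: "\<delta> > 0" "\<delta> \<le> 1 / 2"
    using \<delta>0 r unfolding \<delta>_def by (simp_all only: min.cobounded1, auto)
  have \<delta>r: "\<delta> * (r + 1) < \<delta>0"
  proof -
    have "\<delta> * (r + 1) \<le> \<delta>0 / (2 * (r + 1)) * (r + 1)"
      using r by (intro mult_right_mono) (auto simp: \<delta>_def)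
    also have "\<dots> = \<delta>0 / 2" using r by (simp add: field_simps)
    finally show ?thesis using \<delta>0 by simp
  qed
  show ?thesis
  proof (rule that[OF \<delta>(1)])
    fix x c e :: real assume c: "\<bar>c - 1\<bar> \<le> \<delta>" and e: "\<bar>e\<bar> \<le> \<delta>"
    show "\<bar>g (c * x + e) - g x\<bar> < \<eta>"
    proof (cases "\<bar>x\<bar> \<le> r")
      case True
      have "\<bar>(c - 1) * x\<bar> \<le> \<delta> * r"
        using mult_mono[OF c True] \<delta> by (simp add: abs_mult)
      moreover have "c * x + e - x = (c - 1) * x + e" by (simp add: algebra_simps)
      ultimately have *: "\<bar>c * x + e - x\<bar> \<le> \<delta> * (r + 1)"
        using e by (simp add: algebra_simps)
      have "\<delta> * (r + 1) \<le> 1 / 2 * (r + 1)" using \<delta> r by (intro mult_right_mono) auto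
      moreover have "\<bar>c * x + e\<bar> \<le> \<bar>c * x + e - x\<bar> + \<bar>x\<bar>" by linarith
      ultimately have "\<bar>c * x + e\<bar> \<le> 2 * r"
        using * True r1 by (simp add: field_simps)
      then show ?thesis using * \<delta>r True r by (intro uc) auto
    next
      case False
      have "1 / 2 * \<bar>x\<bar> \<le> \<bar>c\<bar> * \<bar>x\<bar>" using c \<delta> by (intro mult_right_mono) auto
      then have "\<bar>c * x\<bar> \<ge> 1 / 2 * \<bar>x\<bar>" by (simp add: abs_mult)
      then have "\<bar>c * x + e\<bar> > R" using e \<delta> False by (simp add: r_def)
      moreover have "\<bar>x\<bar> > R" using False assms(3) by (simp add: r_def)
      ultimately show ?thesis using supp \<open>\<eta> > 0\<close> by simp
    qed
  qed
qed

text \<open>The points \<open>x n\<close> may be unbounded, because the preceding modulus is uniform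
  in \<open>x\<close>.\<close>

lemma compact_support_affine_tendsto:
  fixes g :: "real \<Rightarrow> real"
  assumes g: "continuous_on UNIV g" and supp: "\<And>x. \<bar>x\<bar> > R \<Longrightarrow> g x = 0" and R: "R \<ge> 0"
    and c: "(c \<longlongrightarrow> 1) F" and e: "(e \<longlongrightarrow> 0) F"
  shows "((\<lambda>n. g (c n * x n + e n) - g (x n)) \<longlongrightarrow> 0) F"
proof (rule tendstoI)
  fix \<eta> :: real assume "\<eta> > 0"
  obtain \<delta> where \<delta>: "\<delta> > 0"
    and *: "\<And>x c e. \<bar>c - 1\<bar> \<le> \<delta> \<Longrightarrow> \<bar>e\<bar> \<le> \<delta> \<Longrightarrow> \<bar>g (c * x + e) - g x\<bar> < \<eta>"
    using compact_support_affine_continuity[OF g supp R \<open>\<eta> > 0\<close>] by blast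
  show "\<forall>\<^sub>F n in F. dist (g (c n * x n + e n) - g (x n)) 0 < \<eta>"
    using tendstoD[OF c \<delta>] tendstoD[OF e \<delta>]
    by eventually_elim (auto simp: dist_real_def intro!: *)
qed

section \<open>Sampling along visits\<close>

text \<open>\<open>c n\<close> counts the visits before time \<open>n\<close>, so it takes the
  values 0, 1, 2, ... at the successive visits and reindexes the sum.\<close>

lemma sum_visits:
  fixes h :: "nat \<Rightarrow> real"
  assumes "\<And>n. c (Suc n) = c n + of_bool (v n)" "c 0 = 0"
  shows "(\<Sum>n<N. of_bool (v n) * h (c n)) = (\<Sum>k<c N. h k)"
  by (induction N) (simp_all add: assms)

text \<open>The visit of index \<open>k\<close> occurs at a time \<open>n\<close> asymptotic to
  \<open>k / m\<close>. There \<open>1 / n\<close> is asymptotic to \<open>m / k\<close>, the source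
  of the factor \<open>m\<close>, and \<open>B n\<close> to \<open>B (k / m)\<close>. The constant
  \<open>a\<close> is what \<open>s\<close> accumulates before counting starts; it is negligible
  against \<open>B\<close>.\<close>

lemma log_average_visits:
  fixes g :: "real \<Rightarrow> real" and c :: "nat \<Rightarrow> nat"
  assumes g: "continuous_on UNIV g" and supp: "\<And>x. \<bar>x\<bar> > R \<Longrightarrow> g x = 0" and R: "R \<ge> 0"
    and gC: "\<And>x. \<bar>g x\<bar> \<le> C"
    and B: "renormalization_function B"
    and c: "\<And>n. c (Suc n) = c n + of_bool (v n)" "c 0 = 0"
    and m: "m > 0" and cm: "(\<lambda>n. real (c n) / real n) \<longlonglongrightarrow> m"
    and s: "\<And>n. v n \<Longrightarrow> s n = a + \<sigma> (c n)"
    and lim: "log_average (\<lambda>k. g (\<sigma> k / B (real k / m))) \<longlonglongrightarrow> I"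
  shows "log_average (\<lambda>n. of_bool (v n) * g (s n / B (real n))) \<longlonglongrightarrow> m * I"
proof -
  define G where "G k = g (\<sigma> k / B (real k / m))" for k
  define h where "h k = 1 / real k * G k" for k
  \<comment> \<open>The factor \<open>n\<close> cancels the weight \<open>1 / n\<close> and leaves
    the weight \<open>1 / c n\<close> of the visit index.\<close>
  define q where "q n = real n * (of_bool (v n) * h (c n))" for n
  have C: "C \<ge> 0" using gC[of 0] by linarith
  have c_top: "filterlim (\<lambda>n. real (c n)) at_top sequentially"
  proof -
    have "filterlim (\<lambda>n. real (c n) / real n * real n) at_top sequentially"
      by (rule filterlim_tendsto_pos_mult_at_top[OF cm m filterlim_real_sequentially])
    moreover have "\<forall>\<^sub>F n in sequentially. real (c n) / real n * real n = real (c n)"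
      using eventually_gt_at_top[of 0] by eventually_elim simp
    ultimately show ?thesis by (simp add: filterlim_cong)
  qed
  \<comment> \<open>Indices start at 0, so the last visit up to time \<open>N\<close>, once there is
    one, has index \<open>K N\<close>.\<close>
  define K where "K N = c (Suc N) - 1" for N
  have K_top: "filterlim K at_top sequentially"
  proof -
    have "filterlim c at_top sequentially"
      unfolding filterlim_at_top
    proof
      fix k
      show "\<forall>\<^sub>F n in sequentially. k \<le> c n"
        using filterlim_at_top[THEN iffD1, OF c_top, rule_format, of "real k"] by simp
    qed
    then have "filterlim (\<lambda>N. c (Suc N)) at_top sequentially"
      using filterlim_compose[OF _ filterlim_Suc] by blast
    then show ?thesis
      unfolding K_def by (rule filterlim_compose[OF filterlim_minus_const_nat_at_top])
  qed
  have K_N: "(\<lambda>N. real (K N) / real N) \<longlonglongrightarrow> m"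
  proof -
    have "(\<lambda>N. real (c (Suc N)) / real (Suc N) * (real (Suc N) / real N) - 1 / real N) \<longlonglongrightarrow> m * 1 - 0"
      by (intro tendsto_diff tendsto_mult LIMSEQ_Suc[OF cm] LIMSEQ_Suc_n_over_n lim_1_over_n)
    moreover have "\<forall>\<^sub>F N in sequentially.
        real (c (Suc N)) / real (Suc N) * (real (Suc N) / real N) - 1 / real N = real (K N) / real N"
      using filterlim_at_top[THEN iffD1, OF K_top, rule_format, of 1] eventually_gt_at_top[of 0]
    proof eventually_elim
      case (elim N)
      then have "real (K N) = real (c (Suc N)) - 1" by (simp add: K_def of_nat_diff)
      then show ?case using elim by (simp add: diff_divide_distrib del: of_nat_Suc)
    qed
    ultimately show ?thesis by (simp add: filterlim_cong)
  qed
  \<comment> \<open>\<open>K N / N\<close> tends to \<open>m\<close>, so \<open>ln (K N)\<close> and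
    \<open>ln N\<close> differ by a convergent amount and the two normalizations agree in the
    limit.\<close>
  have ratio_ln: "(\<lambda>N. ln (real (K N)) / ln (real N)) \<longlonglongrightarrow> 1"
  proof -
    have "(\<lambda>N. ln (real (K N) / real N) / ln (real N) + 1) \<longlonglongrightarrow> 0 + 1"
      using m by (intro tendsto_add tendsto_const real_tendsto_divide_at_top[OF tendsto_ln[OF K_N]] ln_real_at_top) auto
    moreover have "\<forall>\<^sub>F N in sequentially.
        ln (real (K N) / real N) / ln (real N) + 1 = ln (real (K N)) / ln (real N)"
      using filterlim_at_top[THEN iffD1, OF K_top, rule_format, of 1] eventually_gt_at_top[of 1]
      by eventually_elim (simp add: ln_div field_simps)
    ultimately show ?thesis by (simp add: filterlim_cong)
  qed
  have q: "log_average q \<longlonglongrightarrow> I"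
  proof -
    have "(\<lambda>N. ln (real (K N)) / ln (real N) * log_average G (K N)) \<longlonglongrightarrow> 1 * I"
      by (intro tendsto_mult ratio_ln filterlim_compose[OF lim[folded G_def] K_top])
    moreover have "\<forall>\<^sub>F N in sequentially.
        ln (real (K N)) / ln (real N) * log_average G (K N) = log_average q N"
      using filterlim_at_top[THEN iffD1, OF K_top, rule_format, of 2]
    proof eventually_elim
      case (elim N)
      have "(\<Sum>n=1..N. 1 / real n * q n) = (\<Sum>n=1..N. of_bool (v n) * h (c n))"
        by (intro sum.cong) (auto simp: q_def)
      \<comment> \<open>Time 0 may be added here, and index 0 dropped afterwards, because division
        by zero makes \<open>h 0 = 0\<close>.\<close>
      also have "\<dots> = (\<Sum>n<Suc N. of_bool (v n) * h (c n))"
        by (intro sum.mono_neutral_left) (auto simp: c h_def not_less_eq_eq)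
      also have "\<dots> = (\<Sum>k<c (Suc N). h k)" by (rule sum_visits[OF c])
      also have "\<dots> = (\<Sum>k=1..K N. h k)"
        by (intro sum.mono_neutral_right) (auto simp: h_def K_def)
      finally show ?case
        using elim by (simp add: log_average_def h_def)
    qed
    ultimately show ?thesis by (simp add: filterlim_cong)
  qed
  have B_top: "filterlim (\<lambda>n. B (real n)) at_top sequentially"
    by (rule filterlim_compose[OF renormalization_function_at_top[OF B] filterlim_real_sequentially])
  have "(\<lambda>n. real (c n) / real n / m) \<longlonglongrightarrow> m / m" using m by (intro tendsto_divide cm tendsto_const) auto
  then have cm1: "(\<lambda>n. real (c n) / m / real n) \<longlonglongrightarrow> 1" using m by (simp add: mult.commute)
  then have ratio_B: "(\<lambda>n. B (real (c n) / m) / B (real n)) \<longlonglongrightarrow> 1"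
    by (intro renormalization_function_ratio[OF B] filterlim_real_sequentially)
  have aB: "(\<lambda>n. a / B (real n)) \<longlonglongrightarrow> 0"
    by (rule real_tendsto_divide_at_top[OF tendsto_const B_top])
  \<comment> \<open>At a visit, this is the error made in replacing the normalization
    \<open>B n\<close> by \<open>B (c n / m)\<close> and dropping \<open>a\<close>.\<close>
  define \<Delta> where "\<Delta> n = g (B (real (c n) / m) / B (real n) * (\<sigma> (c n) / B (real (c n) / m))
      + a / B (real n)) - g (\<sigma> (c n) / B (real (c n) / m))" for n
  have \<Delta>: "\<Delta> \<longlonglongrightarrow> 0"
    unfolding \<Delta>_def by (rule compact_support_affine_tendsto[OF g supp R ratio_B aB])
  have "(\<lambda>n. 1 - inverse (real (c n) / m / real n)) \<longlonglongrightarrow> 1 - inverse 1"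
    by (intro tendsto_intros cm1) auto
  then have inv: "(\<lambda>n. 1 - m * real n / real (c n)) \<longlonglongrightarrow> 0" by (simp add: field_simps)
  have "(\<lambda>n. of_bool (v n) * g (s n / B (real n)) - m * q n) \<longlonglongrightarrow> 0"
  proof (rule Lim_null_comparison)
    show "(\<lambda>n. \<bar>\<Delta> n\<bar> + C * \<bar>1 - m * real n / real (c n)\<bar>) \<longlonglongrightarrow> 0"
      using tendsto_add[OF tendsto_rabs[OF \<Delta>] tendsto_mult[OF tendsto_const tendsto_rabs[OF inv]]] by simp
    show "\<forall>\<^sub>F n in sequentially. norm (of_bool (v n) * g (s n / B (real n)) - m * q n)
        \<le> \<bar>\<Delta> n\<bar> + C * \<bar>1 - m * real n / real (c n)\<bar>"
      using filterlim_at_top[THEN iffD1, OF c_top, rule_format, of 1] eventually_gt_at_top[of 0]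
    proof eventually_elim
      case (elim n)
      show ?case
      proof (cases "v n")
        case True
        have "B (real (c n) / m) > 0" "B (real n) > 0"
          using elim m by (auto intro!: renormalization_function_pos[OF B])
        then have "s n / B (real n) =
            B (real (c n) / m) / B (real n) * (\<sigma> (c n) / B (real (c n) / m)) + a / B (real n)"
          using s[OF True] by (simp add: field_simps)
        then have "g (s n / B (real n)) = \<Delta> n + G (c n)" by (simp add: \<Delta>_def G_def)
        moreover have "m * q n = m * real n / real (c n) * G (c n)"
          using True by (simp add: q_def h_def)
        ultimately have "of_bool (v n) * g (s n / B (real n)) - m * q n =
            \<Delta> n + G (c n) * (1 - m * real n / real (c n))"
          using True by (simp add: algebra_simps)
        moreover have "\<bar>G (c n) * (1 - m * real n / real (c n))\<bar> \<le> C * \<bar>1 - m * real n / real (c n)\<bar>"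
          unfolding abs_mult using gC by (intro mult_right_mono) (auto simp: G_def)
        ultimately show ?thesis by simp
      next
        case False
        then show ?thesis using C by (simp add: q_def)
      qed
    qed
  qed
  from log_average_tendsto[OF this]
  have "(\<lambda>N. log_average (\<lambda>n. of_bool (v n) * g (s n / B (real n))) N - m * log_average q N) \<longlonglongrightarrow> 0"
    unfolding log_average_cmult[symmetric] log_average_diff[symmetric] .
  from tendsto_add[OF this tendsto_mult[OF tendsto_const q, of m]] show ?thesis by simp
qed

text \<open>Increments of \<open>s\<close> below a fixed threshold vanish against \<open>B\<close>.
  The others change \<open>g\<close> by at most \<open>2 * C\<close>, which is at most
  \<open>\<rho>\<close> times their size, so they contribute at most \<open>\<rho> * J\<close> in
  the limit.\<close>

lemma log_average_increments:
  fixes g :: "real \<Rightarrow> real"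
  assumes g: "continuous_on UNIV g" and supp: "\<And>x. \<bar>x\<bar> > R \<Longrightarrow> g x = 0" and R: "R \<ge> 0"
    and gC: "\<And>x. \<bar>g x\<bar> \<le> C"
    and B: "renormalization_function B"
    and w: "log_average (\<lambda>n. \<bar>s (Suc n) - s n\<bar>) \<longlonglongrightarrow> J"
  shows "log_average (\<lambda>n. \<bar>g (s (Suc n) / B (real (Suc n))) - g (s n / B (real n))\<bar>) \<longlonglongrightarrow> 0"
proof (rule log_average_tendsto_0I)
  fix e :: real assume e: "e > 0"
  \<comment> \<open>This gives \<open>\<rho> * J \<le> e / 4\<close>, and the added 1 covers
    \<open>J = 0\<close>.\<close>
  define \<rho> where "\<rho> = e / (4 * (\<bar>J\<bar> + 1))"
  have \<rho>: "\<rho> > 0" using e by (simp add: \<rho>_def)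
  have \<rho>J: "\<rho> * J < e / 2"
  proof -
    have "\<rho> * J \<le> \<rho> * (\<bar>J\<bar> + 1)" using \<rho> by (intro mult_left_mono) auto
    also have "\<dots> = e / 4" by (simp add: \<rho>_def field_simps)
    finally show ?thesis using e by simp
  qed
  define w where "w n = s (Suc n) - s n" for n
  define \<epsilon> where "\<epsilon> n = (if \<bar>w n\<bar> \<le> 2 * C / \<rho> then w n else 0) / B (real (Suc n))" for n
  have BS: "filterlim (\<lambda>n. B (real (Suc n))) at_top sequentially"
    by (rule filterlim_compose[OF renormalization_function_at_top[OF B]
          filterlim_compose[OF filterlim_real_sequentially filterlim_Suc]])
  have C: "C \<ge> 0" using gC[of 0] by linarith
  have \<epsilon>: "\<epsilon> \<longlonglongrightarrow> 0"
  proof (rule Lim_null_comparison)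
    show "(\<lambda>n. 2 * C / \<rho> / B (real (Suc n))) \<longlonglongrightarrow> 0"
      by (rule real_tendsto_divide_at_top[OF tendsto_const BS])
    show "\<forall>\<^sub>F n in sequentially. norm (\<epsilon> n) \<le> 2 * C / \<rho> / B (real (Suc n))"
    proof (intro always_eventually allI)
      fix n
      have "B (real (Suc n)) > 0" by (rule renormalization_function_pos[OF B]) simp
      moreover have "\<bar>if \<bar>w n\<bar> \<le> 2 * C / \<rho> then w n else 0\<bar> \<le> 2 * C / \<rho>" using C \<rho> by auto
      ultimately show "norm (\<epsilon> n) \<le> 2 * C / \<rho> / B (real (Suc n))"
        unfolding \<epsilon>_def real_norm_def abs_divide by (simp only: abs_of_pos divide_right_mono less_imp_le)
    qed
  qed
  have "(\<lambda>n. real n / real (Suc n)) \<longlonglongrightarrow> 1" by (rule LIMSEQ_n_over_Suc_n)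
  then have rB: "(\<lambda>n. B (real n) / B (real (Suc n))) \<longlonglongrightarrow> 1"
    by (intro renormalization_function_ratio[OF B] filterlim_compose[OF filterlim_real_sequentially filterlim_Suc])
  have "(\<lambda>n. g (B (real n) / B (real (Suc n)) * (s n / B (real n)) + \<epsilon> n) - g (s n / B (real n))) \<longlonglongrightarrow> 0"
    by (rule compact_support_affine_tendsto[OF g supp R rB \<epsilon>])
  from tendstoD[OF this half_gt_zero[OF e]] eventually_gt_at_top[of 0]
  have "\<forall>\<^sub>F n in sequentially. \<bar>\<bar>g (s (Suc n) / B (real (Suc n))) - g (s n / B (real n))\<bar>\<bar>
      \<le> e / 2 * 1 + \<rho> * \<bar>s (Suc n) - s n\<bar>"
  proof eventually_elim
    case (elim n)
    show ?case
    proof (cases "\<bar>w n\<bar> \<le> 2 * C / \<rho>")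
      case True
      have "B (real n) > 0" "B (real (Suc n)) > 0"
        using elim by (auto intro!: renormalization_function_pos[OF B])
      then have "s (Suc n) / B (real (Suc n)) = B (real n) / B (real (Suc n)) * (s n / B (real n)) + \<epsilon> n"
        using True by (simp add: \<epsilon>_def w_def field_simps del: of_nat_Suc)
      then show ?thesis using elim \<rho> by (simp add: dist_real_def add_increasing2)
    next
      case False
      then have "2 * C \<le> \<rho> * \<bar>w n\<bar>" using \<rho> by (simp add: field_simps)
      then show ?thesis
        using gC[of "s (Suc n) / B (real (Suc n))"] gC[of "s n / B (real n)"] e
        unfolding w_def by linarith
    qed
  qed
  moreover have "(\<lambda>N. e / 2 * log_average (\<lambda>_. 1) N + \<rho> * log_average (\<lambda>n. \<bar>s (Suc n) - s n\<bar>) N)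
      \<longlonglongrightarrow> e / 2 * 1 + \<rho> * J"
    by (intro tendsto_add tendsto_mult tendsto_const log_average_1 assms)
  then have "log_average (\<lambda>n. e / 2 * 1 + \<rho> * \<bar>s (Suc n) - s n\<bar>) \<longlonglongrightarrow> e / 2 * 1 + \<rho> * J"
    unfolding log_average_add log_average_cmult .
  moreover have "e / 2 * 1 + \<rho> * J < e" using \<rho>J by simp
  ultimately show "\<exists>v c. (\<forall>\<^sub>F n in sequentially. \<bar>\<bar>g (s (Suc n) / B (real (Suc n))) - g (s n / B (real n))\<bar>\<bar> \<le> v n)
      \<and> log_average v \<longlonglongrightarrow> c \<and> c < e" by (intro exI conjI)
qed

text \<open>Cut the orbit at the first return: the first piece sums to
  \<open>induced_function T Y f y\<close> and contains one visit, and the rest is the same claim for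
  the returned point and a shorter time.\<close>

lemma induced_birkhoff_sum_at_visit:
  assumes "y \<in> Y" "(T ^^ n) y \<in> Y" "real k = birkhoff_sum T (indicator Y) n y"
  shows "birkhoff_sum (induced_map T Y) (induced_function T Y f) k y = birkhoff_sum T f n y"
  using assms
proof (induction n arbitrary: y k rule: less_induct)
  case (less n)
  show ?case
  proof (cases "n = 0")
    case True
    with less.prems show ?thesis by simp
  next
    case False
    define A where "A = {j. j > 0 \<and> (T ^^ j) y \<in> Y}"
    define r where "r = return_time T Y y"
    have r_Inf: "r = Inf A" by (simp add: r_def return_time_def A_def)
    \<comment> \<open>Time \<open>n\<close> is itself a return, so the infimum is attained without
      any appeal to recurrence.\<close>
    have nA: "n \<in> A" using False less.prems by (simp add: A_def)
    then have "r \<in> A" unfolding r_Inf by (intro Inf_nat_def1) auto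
    then have r: "r > 0" "(T ^^ r) y \<in> Y" by (auto simp: A_def)
    have rn: "r \<le> n" unfolding r_Inf using nA by (rule cInf_lower) auto
    have noY: "(T ^^ j) y \<notin> Y" if "0 < j" "j < r" for j
      using that cInf_lower[of j A] by (force simp: A_def r_Inf)
    have one: "birkhoff_sum T (indicator Y) r y = (1 :: real)"
    proof -
      have "birkhoff_sum T (indicator Y) r y = (\<Sum>j\<in>{0}. indicator Y ((T ^^ j) y) :: real)"
        unfolding birkhoff_sum_def using r noY by (intro sum.mono_neutral_right) (auto simp: indicator_def)
      with less.prems show ?thesis by simp
    qed
    have split: "birkhoff_sum T u n y = birkhoff_sum T u r y + birkhoff_sum T u (n - r) ((T ^^ r) y)" for u
      using birkhoff_sum_add[of T u r "n - r" y] rn by simp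
    have "birkhoff_sum T (indicator Y) (n - r) ((T ^^ r) y) \<ge> (0 :: real)"
      by (simp add: birkhoff_sum_def sum_nonneg)
    then have "real k \<ge> 1" using less.prems(3) split[of "indicator Y"] one by simp
    then obtain k' where k: "k = Suc k'" by (cases k) auto
    have "birkhoff_sum (induced_map T Y) (induced_function T Y f) k' ((T ^^ r) y) =
        birkhoff_sum T f (n - r) ((T ^^ r) y)"
    proof (rule less.IH)
      show "n - r < n" using r False by simp
      have "(T ^^ (n - r)) ((T ^^ r) y) = (T ^^ n) y"
        using rn funpow_add[of "n - r" r T] by simp
      then show "(T ^^ (n - r)) ((T ^^ r) y) \<in> Y" using less.prems by simp
      show "real k' = birkhoff_sum T (indicator Y) (n - r) ((T ^^ r) y)"
        using less.prems(3) split[of "indicator Y"] one k by simp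
    qed (use r in auto)
    moreover have "induced_function T Y f y = birkhoff_sum T f r y"
      using less.prems by (simp add: induced_function_def birkhoff_sum_def r_def)
    moreover have "induced_map T Y y = (T ^^ r) y" by (simp add: induced_map_def r_def)
    ultimately show ?thesis
      using split[of f] k by (simp add: birkhoff_sum_Suc)
  qed
qed

section \<open>Weak convergence\<close>

lemma integral_log_empirical_measure_eq_log_average:
  assumes "continuous_on UNIV g"
  shows "(\<integral>z. g z \<partial>log_empirical_measure N x) = log_average (\<lambda>k. g (x k)) N"
  using assms
  by (simp add: integral_log_empirical_measure borel_measurable_continuous_onI log_average_def)

text \<open>The trapezoids equal 1 on \<open>{-n..n}\<close> and vanish beyond \<open>n + 1\<close>:
  they are compactly supported test functions that exhaust the total mass.\<close>

lemma integral_cutoff_tendsto_1: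
  assumes "prob_space \<nu>" "sets \<nu> = sets borel"
  shows "(\<lambda>n. \<integral>x. max 0 (min 1 (real n + 1 - \<bar>x\<bar>)) \<partial>\<nu>) \<longlonglongrightarrow> 1"
proof -
  interpret prob_space \<nu> by fact
  have [measurable_cong]: "sets \<nu> = sets borel" by fact
  have "(\<lambda>n. \<integral>x. max 0 (min 1 (real n + 1 - \<bar>x\<bar>)) \<partial>\<nu>) \<longlonglongrightarrow> (\<integral>x. 1 \<partial>\<nu>)"
  proof (rule integral_dominated_convergence[where w = "\<lambda>_. 1"])
    show "AE x in \<nu>. (\<lambda>n. max 0 (min 1 (real n + 1 - \<bar>x\<bar>))) \<longlonglongrightarrow> 1"
    proof (rule AE_I2)
      fix x :: real
      obtain k :: nat where k: "\<bar>x\<bar> \<le> real k" using real_arch_simple by blast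
      have "\<forall>\<^sub>F n in sequentially. max 0 (min 1 (real n + 1 - \<bar>x\<bar>)) = 1"
        using eventually_ge_at_top[of k] by eventually_elim (use k in auto)
      then show "(\<lambda>n. max 0 (min 1 (real n + 1 - \<bar>x\<bar>))) \<longlonglongrightarrow> 1"
        by (rule tendsto_eventually)
    qed
  qed auto
  then show ?thesis using prob_space by simp
qed

text \<open>No mass escapes to infinity because the limit is a probability measure.\<close>

lemma weakly_converges_log_empirical_measureI:
  assumes \<nu>: "prob_space \<nu>" "sets \<nu> = sets borel"
    and cs: "\<And>g R. continuous_on UNIV g \<Longrightarrow> R \<ge> 0 \<Longrightarrow> (\<And>x. \<bar>x\<bar> > R \<Longrightarrow> g x = 0) \<Longrightarrow>
      log_average (\<lambda>k. g (z k)) \<longlonglongrightarrow> (\<integral>x. g x \<partial>\<nu>)"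
  shows "weakly_converges (\<lambda>N. log_empirical_measure N z) \<nu>"
  unfolding weakly_converges_def
proof (intro allI impI, elim conjE)
  fix h :: "real \<Rightarrow> real" assume h: "continuous_on UNIV h" and "bounded (range h)"
  then obtain C where C: "C > 0" "\<And>x. \<bar>h x\<bar> \<le> C"
    by (auto simp: bounded_pos)
  interpret prob_space \<nu> by (rule \<nu>)
  have [measurable_cong]: "sets \<nu> = sets borel" by (rule \<nu>)
  have [measurable]: "h \<in> borel_measurable borel" using h by (rule borel_measurable_continuous_onI)
  have "log_average (\<lambda>k. h (z k)) \<longlonglongrightarrow> (\<integral>x. h x \<partial>\<nu>)"
  proof (rule tendstoI)
    fix e :: real assume e: "e > 0"
    define \<kappa> where "\<kappa> n x = max 0 (min 1 (real n + 1 - \<bar>x\<bar>))" for n x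
    have \<kappa>01: "0 \<le> \<kappa> n x" "\<kappa> n x \<le> 1" for n x by (auto simp: \<kappa>_def)
    have h\<kappa>: "\<bar>h x * \<kappa> n x\<bar> \<le> C" for n x
      using mult_mono[OF C(2)[of x] \<kappa>01(2)[of n x]] C(1) \<kappa>01 by (simp add: abs_mult)
    \<comment> \<open>The cutoff costs at most \<open>C * (1 - \<kappa> n x)\<close>. The averages
      of this bound converge by \<open>log_average_1\<close> and by \<open>cs\<close> for
      \<open>\<kappa> n\<close>, which controls the mass far out.\<close>
    have hm: "\<bar>h x - h x * \<kappa> n x\<bar> \<le> C * (1 - \<kappa> n x)" for n x
    proof -
      have "h x - h x * \<kappa> n x = h x * (1 - \<kappa> n x)" by (simp add: algebra_simps)
      then show ?thesis using mult_right_mono[OF C(2)[of x], of "1 - \<kappa> n x"] \<kappa>01[of n x] by (simp add: abs_mult)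
    qed
    have cont: "continuous_on UNIV (\<kappa> n)" for n
      unfolding \<kappa>_def by (intro continuous_on_max continuous_on_min continuous_intros)
    have \<kappa>_supp: "\<kappa> n x = 0" if "\<bar>x\<bar> > real n + 1" for n x
      using that by (simp add: \<kappa>_def)
    have [measurable]: "\<kappa> n \<in> borel_measurable borel" for n
      using cont by (rule borel_measurable_continuous_onI)
    define \<epsilon> where "\<epsilon> = e / (8 * C)"
    have \<epsilon>: "\<epsilon> > 0" "C * \<epsilon> = e / 8" using C e by (simp_all add: \<epsilon>_def)
    have "\<forall>\<^sub>F n in sequentially. (\<integral>x. \<kappa> n x \<partial>\<nu>) > 1 - \<epsilon>"
      using order_tendstoD(1)[OF integral_cutoff_tendsto_1[OF \<nu>], of "1 - \<epsilon>"] \<epsilon> by (simp add: \<kappa>_def)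
    then obtain n where n: "(\<integral>x. \<kappa> n x \<partial>\<nu>) > 1 - \<epsilon>"
      using eventually_happens'[of sequentially] by auto
    have int: "integrable \<nu> h" "integrable \<nu> (\<lambda>x. h x * \<kappa> n x)"
      using C(2) h\<kappa> by (auto intro!: integrable_const_bound[where B = C])
    have int\<kappa>: "integrable \<nu> (\<kappa> n)"
      using \<kappa>01 by (auto intro!: integrable_const_bound[where B = 1])
    have "\<bar>(\<integral>x. h x \<partial>\<nu>) - (\<integral>x. h x * \<kappa> n x \<partial>\<nu>)\<bar> = \<bar>\<integral>x. h x - h x * \<kappa> n x \<partial>\<nu>\<bar>"
      using int by simp
    also have "\<dots> \<le> (\<integral>x. C * (1 - \<kappa> n x) \<partial>\<nu>)"
    proof (rule order_trans[OF integral_abs_bound])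
      show "(\<integral>x. \<bar>h x - h x * \<kappa> n x\<bar> \<partial>\<nu>) \<le> (\<integral>x. C * (1 - \<kappa> n x) \<partial>\<nu>)"
        using int int\<kappa> hm by (intro integral_mono) auto
    qed
    also have "\<dots> = C * (1 - (\<integral>x. \<kappa> n x \<partial>\<nu>))" using int\<kappa> prob_space by simp
    also have "\<dots> < C * \<epsilon>" using n C(1) by (intro mult_strict_left_mono) auto
    finally have I: "\<bar>(\<integral>x. h x \<partial>\<nu>) - (\<integral>x. h x * \<kappa> n x \<partial>\<nu>)\<bar> < e / 8" using \<epsilon> by simp
    have 1: "log_average (\<lambda>k. h (z k) * \<kappa> n (z k)) \<longlonglongrightarrow> (\<integral>x. h x * \<kappa> n x \<partial>\<nu>)"
      by (rule cs[of _ "real n + 1"]) (auto intro!: continuous_on_mult h cont simp: \<kappa>_supp)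
    have 2: "log_average (\<lambda>k. \<kappa> n (z k)) \<longlonglongrightarrow> (\<integral>x. \<kappa> n x \<partial>\<nu>)"
      by (rule cs[of _ "real n + 1"]) (auto intro!: cont simp: \<kappa>_supp)
    have "(\<lambda>N. log_average (\<lambda>_. 1) N - log_average (\<lambda>k. \<kappa> n (z k)) N) \<longlonglongrightarrow> 1 - (\<integral>x. \<kappa> n x \<partial>\<nu>)"
      by (intro tendsto_diff log_average_1 2)
    then have "\<forall>\<^sub>F N in sequentially. log_average (\<lambda>_. 1) N - log_average (\<lambda>k. \<kappa> n (z k)) N < \<epsilon>"
      using n by (intro order_tendstoD(2)) auto
    moreover have "\<forall>\<^sub>F N in sequentially.
        \<bar>log_average (\<lambda>k. h (z k) * \<kappa> n (z k)) N - (\<integral>x. h x * \<kappa> n x \<partial>\<nu>)\<bar> < e / 8"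
      using tendstoD[OF 1, of "e / 8"] e by (simp add: dist_real_def)
    ultimately show "\<forall>\<^sub>F N in sequentially. dist (log_average (\<lambda>k. h (z k)) N) (\<integral>x. h x \<partial>\<nu>) < e"
    proof eventually_elim
      case (elim N)
      have "\<bar>log_average (\<lambda>k. h (z k) - h (z k) * \<kappa> n (z k)) N\<bar> \<le> log_average (\<lambda>k. C * (1 - \<kappa> n (z k))) N"
        by (intro abs_log_average_le hm)
      also have "\<dots> = C * (log_average (\<lambda>_. 1) N - log_average (\<lambda>k. \<kappa> n (z k)) N)"
        unfolding log_average_cmult log_average_diff ..
      also have "\<dots> < C * \<epsilon>" using elim(1) C(1) by (rule mult_strict_left_mono)
      finally have "\<bar>log_average (\<lambda>k. h (z k)) N - log_average (\<lambda>k. h (z k) * \<kappa> n (z k)) N\<bar> < e / 8"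
        using \<epsilon> by (simp add: log_average_diff)
      with elim(2) I show ?case unfolding dist_real_def by linarith
    qed
  qed
  then show "(\<lambda>N. \<integral>x. h x \<partial>log_empirical_measure N z) \<longlonglongrightarrow> (\<integral>x. h x \<partial>\<nu>)"
    unfolding integral_log_empirical_measure_eq_log_average[OF h] .
qed

lemma compact_support_bounded:
  fixes g :: "real \<Rightarrow> real"
  assumes g: "continuous_on UNIV g" and supp: "\<And>x. \<bar>x\<bar> > R \<Longrightarrow> g x = 0"
  obtains C where "\<And>x. \<bar>g x\<bar> \<le> C"
proof -
  have "compact (g ` {-R..R})" by (intro compact_continuous_image continuous_on_subset[OF g]) auto
  then have "bounded (g ` {-R..R})" by (rule compact_imp_bounded)
  then obtain C where C: "\<And>x. x \<in> {-R..R} \<Longrightarrow> \<bar>g x\<bar> \<le> C"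
    unfolding bounded_iff by fastforce
  show ?thesis
  proof (rule that[of "max C 0"])
    fix x show "\<bar>g x\<bar> \<le> max C 0"
    proof (cases "\<bar>x\<bar> > R")
      case False
      then have "x \<in> {-R..R}" by auto
      then show ?thesis by (rule max.coboundedI1[OF C])
    qed (simp add: supp)
  qed
qed

section \<open>Transfer from the induced map\<close>

text \<open>This is the argument along a single orbit; ergodicity enters only through the limits
  assumed at \<open>x\<close>. After time \<open>p\<close> the orbit is at a point of
  \<open>Y\<close> where the averages for the induced map converge.\<close>

lemma log_average_orbit:
  fixes g :: "real \<Rightarrow> real" and T :: "'a \<Rightarrow> 'a" and Y :: "'a set" and m :: real
  defines "\<psi> \<equiv> \<lambda>x. indicator Y x - m"
  assumes g: "continuous_on UNIV g" and supp: "\<And>x. \<bar>x\<bar> > R \<Longrightarrow> g x = 0" and R: "R \<ge> 0"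
    and B: "renormalization_function B"
    and m: "m > 0" "m \<le> 1"
    and visits: "(\<lambda>n. birkhoff_sum T (indicator Y) n x / real n) \<longlonglongrightarrow> m"
    and absf: "(\<lambda>n. birkhoff_sum T (\<lambda>x. \<bar>f x\<bar>) n x / real n) \<longlonglongrightarrow> J"
    and windows: "\<And>l. l > 0 \<Longrightarrow>
      (\<lambda>n. birkhoff_sum T (\<lambda>x. \<bar>birkhoff_sum T \<psi> l x / real l\<bar>) n x / real n) \<longlonglongrightarrow> c l"
    and c: "c \<longlonglongrightarrow> 0"
    and y: "(T ^^ p) x \<in> Y"
    and lim: "log_average (\<lambda>k. g (birkhoff_sum (induced_map T Y) (induced_function T Y f) k ((T ^^ p) x)
      / B (real k / m))) \<longlonglongrightarrow> I"
  shows "log_average (\<lambda>n. g (birkhoff_sum T f n x / B (real n))) \<longlonglongrightarrow> I"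
proof -
  obtain C where C: "\<And>x. \<bar>g x\<bar> \<le> C" using compact_support_bounded[OF g supp] by blast
  define b where "b n = g (birkhoff_sum T f n x / B (real n))" for n
  \<comment> \<open>Visits before time \<open>p\<close> are ignored, so that counting starts with
    index 0 at \<open>(T ^^ p) x\<close>.\<close>
  define v where "v n \<longleftrightarrow> n \<ge> p \<and> (T ^^ n) x \<in> Y" for n
  define k where "k n = (\<Sum>j<n. of_bool (v j) :: nat)" for n
  have k_shift: "real (k (p + n)) = birkhoff_sum T (indicator Y) n ((T ^^ p) x)" for n
  proof -
    have "k (p + n) = (\<Sum>j<n. of_bool (v (p + j)))"
      unfolding k_def by (induction n) (simp_all add: v_def)
    then show ?thesis
      by (simp add: birkhoff_sum_def v_def indicator_def funpow_add add.commute of_bool_def if_distrib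
          cong: if_cong)
  qed
  have "(\<lambda>n. real (k n) / real n) \<longlonglongrightarrow> m - 0"
  proof (rule Lim_transform_eventually)
    show "(\<lambda>n. birkhoff_sum T (indicator Y) n x / real n - birkhoff_sum T (indicator Y) p x / real n) \<longlonglongrightarrow> m - 0"
      by (intro tendsto_diff visits real_tendsto_divide_at_top[OF tendsto_const] filterlim_real_sequentially)
    show "\<forall>\<^sub>F n in sequentially. birkhoff_sum T (indicator Y) n x / real n - birkhoff_sum T (indicator Y) p x / real n
        = real (k n) / real n"
      using eventually_ge_at_top[of p]
    proof eventually_elim
      case (elim n)
      then show ?case
        using k_shift[of "n - p"] birkhoff_sum_add[of T "indicator Y" p "n - p" x]
        by (simp add: diff_divide_distrib[symmetric])
    qed
  qed
  then have km: "(\<lambda>n. real (k n) / real n) \<longlonglongrightarrow> m" by simp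
  have "log_average (\<lambda>n. of_bool (v n) * b n) \<longlonglongrightarrow> m * I"
    unfolding b_def
  proof (rule log_average_visits[OF g supp R C B _ _ m(1) km _ lim])
    fix n assume "v n"
    then obtain q where n: "n = p + q" and "(T ^^ n) x \<in> Y" by (auto simp: v_def le_iff_add)
    then have "(T ^^ q) ((T ^^ p) x) \<in> Y" using funpow_add[of q p T] by (simp add: add.commute)
    from induced_birkhoff_sum_at_visit[OF y this k_shift, of f] show "birkhoff_sum T f n x = birkhoff_sum T f p x +
        birkhoff_sum (induced_map T Y) (induced_function T Y f) (k n) ((T ^^ p) x)"
      unfolding n birkhoff_sum_add by simp
  qed (simp_all add: k_def)
  moreover have "log_average (\<lambda>n. (indicator Y ((T ^^ n) x) - of_bool (v n)) * b n) \<longlonglongrightarrow> 0"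
    using eventually_ge_at_top[of p]
    by (intro log_average_eventually_0, eventually_elim) (simp add: v_def indicator_def)
  moreover have "log_average (\<lambda>n. b n * \<psi> ((T ^^ n) x)) \<longlonglongrightarrow> 0"
  proof (rule log_average_mult_tendsto_0)
    show "\<bar>b n\<bar> \<le> C" for n by (simp add: b_def C)
    show "\<bar>\<psi> ((T ^^ n) x)\<bar> \<le> 1" for n using m by (auto simp: \<psi>_def indicator_def)
    show "log_average (\<lambda>n. \<bar>b (Suc n) - b n\<bar>) \<longlonglongrightarrow> 0"
      unfolding b_def
    proof (rule log_average_increments[OF g supp R C B])
      show "log_average (\<lambda>n. \<bar>birkhoff_sum T f (Suc n) x - birkhoff_sum T f n x\<bar>) \<longlonglongrightarrow> J"
        using log_average_tendsto_of_cesaro[OF absf[unfolded birkhoff_sum_def]]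
        by (simp add: birkhoff_sum_def)
    qed
    fix e :: real assume "e > 0"
    then have "\<forall>\<^sub>F l in sequentially. c l < e" using c by (intro order_tendstoD) auto
    then have "\<forall>\<^sub>F l in sequentially. c l < e \<and> l > 0" using eventually_gt_at_top[of 0] by (rule eventually_conj)
    then obtain l where l: "c l < e" "l > 0" using eventually_happens'[of sequentially] by auto
    have "(T ^^ (n + i)) x = (T ^^ i) ((T ^^ n) x)" for n i
      using funpow_add[of i n T] by (simp add: add.commute)
    then have "log_average (\<lambda>n. \<bar>(\<Sum>i<l. \<psi> ((T ^^ (n + i)) x)) / real l\<bar>) \<longlonglongrightarrow> c l"
      using log_average_tendsto_of_cesaro[OF windows[OF l(2), unfolded birkhoff_sum_def[of _ _ _ x]]]
      by (simp add: birkhoff_sum_def)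
    with l show "\<exists>l>0. \<exists>c<e. log_average (\<lambda>n. \<bar>(\<Sum>i<l. \<psi> ((T ^^ (n + i)) x)) / real l\<bar>) \<longlonglongrightarrow> c" by blast
  qed
  \<comment> \<open>The three limits recombine to that of \<open>b\<close> because
    \<open>indicator Y\<close> is \<open>\<psi>\<close> plus the constant \<open>m\<close>.\<close>
  ultimately have "(\<lambda>N. 1 / m * (log_average (\<lambda>n. of_bool (v n) * b n) N
      + log_average (\<lambda>n. (indicator Y ((T ^^ n) x) - of_bool (v n)) * b n) N
      - log_average (\<lambda>n. b n * \<psi> ((T ^^ n) x)) N)) \<longlonglongrightarrow> 1 / m * (m * I + 0 - 0)"
    by (intro tendsto_mult tendsto_add tendsto_diff tendsto_const)
  moreover have "1 / m * (of_bool (v n) * b n + (indicator Y ((T ^^ n) x) - of_bool (v n)) * b n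
      - b n * \<psi> ((T ^^ n) x)) = b n" for n
    using m by (simp add: \<psi>_def field_simps)
  ultimately show ?thesis
    using m unfolding log_average_cmult[symmetric] log_average_diff[symmetric] log_average_add[symmetric]
    by (simp add: b_def)
qed

theorem theorem2p14:
  fixes M :: "'a measure" and T :: "'a \<Rightarrow> 'a" and Y :: "'a set" and f :: "'a \<Rightarrow> real"
    and B :: "real \<Rightarrow> real" and P :: "'b measure" and W :: "'b \<Rightarrow> real"
  assumes "prob_space M"
    and "ergodic_endomorphism M T"
    and "Y \<in> sets M" and "measure M Y > 0"
    and "integrable M f"
    and "renormalization_function B"
    and "prob_space P" and "W \<in> borel_measurable P"
    and "almost_sure_limit_theorem (uniform_measure M Y)
           (birkhoff_sum (induced_map T Y) (induced_function T Y f))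
           (\<lambda>n. B (real n / measure M Y)) P W"
  shows "almost_sure_limit_theorem M (birkhoff_sum T f) (\<lambda>n. B (real n)) P W"
proof -
  interpret prob_space M by fact
  interpret P: prob_space P by fact
  note Y[measurable] = \<open>Y \<in> sets M\<close>
  note birkhoff = birkhoff_ergodic[OF assms(1,2)]
  have [measurable]: "T \<in> measurable M M"
    using assms(2) by (simp add: ergodic_endomorphism_def measure_preserving_map_def)
  define m where "m = prob Y"
  have m: "m > 0" "m \<le> 1" using assms(4) by (simp_all add: m_def)
  define \<psi> where "\<psi> x = indicator Y x - m" for x
  have \<psi>_eq: "\<psi> = (\<lambda>x. indicator Y x - m)" by (simp add: fun_eq_iff \<psi>_def)
  have [measurable]: "\<psi> \<in> borel_measurable M" unfolding \<psi>_def by measurable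
  have iY: "integrable M (indicator A :: 'a \<Rightarrow> real)" if "A \<in> sets M" for A
    using that by (simp add: emeasure_eq_measure)
  have i\<psi>: "integrable M \<psi>" "(\<integral>x. \<psi> x \<partial>M) = 0"
    unfolding \<psi>_def using iY[OF Y] prob_space by (simp_all add: m_def)
  have window_le: "\<bar>birkhoff_sum T \<psi> l x / real l\<bar> \<le> 1" for l x
  proof -
    have "\<bar>birkhoff_sum T \<psi> l x\<bar> \<le> (\<Sum>k<l. \<bar>\<psi> ((T ^^ k) x)\<bar>)"
      unfolding birkhoff_sum_def by (rule sum_abs)
    also have "\<dots> \<le> (\<Sum>k<l. 1)"
      using m by (intro sum_mono) (auto simp: \<psi>_def indicator_def)
    finally show ?thesis by (cases "l = 0") (simp_all add: abs_divide)
  qed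
  define c where "c l = (\<integral>x. \<bar>birkhoff_sum T \<psi> l x / real l\<bar> \<partial>M)" for l
  have i_window: "integrable M (\<lambda>x. \<bar>birkhoff_sum T \<psi> l x / real l\<bar>)" for l
    using window_le by (intro integrable_const_bound[where B = 1]) auto
  \<comment> \<open>The window means tend to 0 almost everywhere and are bounded by 1, hence they
    tend to 0 in mean.\<close>
  have c: "c \<longlonglongrightarrow> 0"
  proof -
    have "c \<longlonglongrightarrow> (\<integral>x. 0 \<partial>M)"
      unfolding c_def
    proof (rule integral_dominated_convergence[where w = "\<lambda>_. 1"])
      show "AE x in M. (\<lambda>l. \<bar>birkhoff_sum T \<psi> l x / real l\<bar>) \<longlonglongrightarrow> 0"
        using birkhoff[OF i\<psi>(1)] unfolding i\<psi>(2) by eventually_elim (rule tendsto_rabs_zero)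
    qed (use window_le in auto)
    then show ?thesis by simp
  qed
  define good where "good y \<longleftrightarrow> weakly_converges (\<lambda>N. log_empirical_measure N
      (\<lambda>k. birkhoff_sum (induced_map T Y) (induced_function T Y f) k y / B (real k / m))) (distr P borel W)" for y
  have "AE y in M. y \<in> Y \<longrightarrow> good y"
    using assms(4,9) unfolding almost_sure_limit_theorem_def good_def m_def
    by (subst (asm) AE_uniform_measure) (auto simp: emeasure_eq_measure)
  \<comment> \<open>Removing a null set from \<open>Y\<close> yields a measurable set of good points
    without examining the measurability of \<open>good\<close>.\<close>
  then obtain N where N: "N \<in> null_sets M" "\<And>y. y \<in> space M - N \<Longrightarrow> y \<in> Y \<Longrightarrow> good y"
    by (elim AE_E3) auto
  define G where "G = Y - N"
  have [measurable]: "G \<in> sets M" using N Y by (auto simp: G_def)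
  have G_pos: "prob G > 0"
    using N Y assms(4) by (simp add: G_def measure_Diff_null_set)
  have G: "y \<in> Y" "good y" if "y \<in> G" for y
    using that N(2) sets.sets_into_space[OF Y] by (auto simp: G_def)
  \<comment> \<open>Almost every orbit visits \<open>G\<close> with frequency
    \<open>prob G > 0\<close>, hence at least once. This carries the conclusion from
    \<open>Y\<close> to the whole space.\<close>
  have reach: "AE x in M. \<exists>p. (T ^^ p) x \<in> G"
    using birkhoff[OF iY[OF \<open>G \<in> sets M\<close>]]
  proof eventually_elim
    case (elim x)
    show ?case
    proof (rule ccontr)
      assume "\<nexists>p. (T ^^ p) x \<in> G"
      then have "(\<lambda>n. birkhoff_sum T (indicator G) n x / real n) = (\<lambda>_. 0 :: real)"
        by (simp add: birkhoff_sum_def)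
      with elim have "(\<lambda>_. 0 :: real) \<longlonglongrightarrow> prob G" by simp
      then show False using G_pos LIMSEQ_unique[OF _ tendsto_const] by fastforce
    qed
  qed
  have visits: "AE x in M. (\<lambda>n. birkhoff_sum T (indicator Y) n x / real n) \<longlonglongrightarrow> m"
    using birkhoff[OF iY[OF Y]] by (simp add: m_def)
  have windows: "AE x in M. \<forall>l. (\<lambda>n. birkhoff_sum T (\<lambda>x. \<bar>birkhoff_sum T \<psi> l x / real l\<bar>) n x / real n) \<longlonglongrightarrow> c l"
    unfolding AE_all_countable c_def by (intro allI birkhoff i_window)
  show ?thesis
    unfolding almost_sure_limit_theorem_def
    using reach visits windows birkhoff[OF integrable_abs[OF assms(5)]]
  proof eventually_elim
    case (elim x)
    then obtain p where p: "(T ^^ p) x \<in> G" by blast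
    show ?case
    proof (rule weakly_converges_log_empirical_measureI)
      show "prob_space (distr P borel W)" using assms(8) by (rule P.prob_space_distr)
      fix g :: "real \<Rightarrow> real" and R
      assume g: "continuous_on UNIV g" and R: "R \<ge> 0" and supp: "\<And>x. \<bar>x\<bar> > R \<Longrightarrow> g x = 0"
      obtain C where "\<And>x. \<bar>g x\<bar> \<le> C" using compact_support_bounded[OF g supp] by blast
      then have "bounded (range g)" by (auto simp: bounded_iff)
      with G(2)[OF p] g have lim: "log_average (\<lambda>k. g (birkhoff_sum (induced_map T Y) (induced_function T Y f) k
          ((T ^^ p) x) / B (real k / m))) \<longlonglongrightarrow> (\<integral>x. g x \<partial>distr P borel W)"
        unfolding good_def weakly_converges_def integral_log_empirical_measure_eq_log_average[OF g, symmetric]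
        by blast
      show "log_average (\<lambda>k. g (birkhoff_sum T f k x / B (real k))) \<longlonglongrightarrow> (\<integral>x. g x \<partial>distr P borel W)"
      proof (rule log_average_orbit[OF g supp R assms(6) m elim(2,4) _ c G(1)[OF p] lim])
        show "(\<lambda>n. birkhoff_sum T (\<lambda>x. \<bar>birkhoff_sum T (\<lambda>x. indicator Y x - m) l x / real l\<bar>) n x / real n)
            \<longlonglongrightarrow> c l" for l
          using elim(3) unfolding \<psi>_eq by blast
      qed
    qed simp
  qed
qed

end
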